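(* Suppose $(W,S)$ satisfies condition (A). Then $G$ is not of type $\mathrm{FP}_2$; in particular $G$ is not finitely presented.
   Context: Condition (A): $S=J\sqcup K$ with $|K|\ge2$, such that $J\cup\{s\}$ is spherical for every $s\in K$ and $m(s,t)=\infty$ for all distinct $s,t\in K$. Standing setup: $(W,S)$ is a Coxeter system with finite $S=\{s_1,\dots,s_n\}$ and $m(s,t)$ the order of $st$; for $J\subseteq S$, $W_J=\langle J\rangle$, and $J$ is spherical if $W_J$ is finite. $(\Delta_+,\Delta_-,\delta^* )$ is a thick twin building of type $(W,S)$ with Weyl distances $\delta_\pm$ and codistance $\delta^*$. There are integers $q_i\ge2$ such that every $s_i$-panel contains exactly $q_i+1$ chambers. A group $G$ acts strongly transitively on the twin building, i.e. by automorphisms preserving $\delta_+,\delta_-,\delta^*$ and transitively on pairs $(\Sigma,C)$ with $\Sigma$ a twin apartment and $C$ a chamber of $\Sigma$. For fixed opposite chambers $C_\pm$, $B_\pm=G_{C_\pm}$, and $T=B_+\cap B_-$ is assumed finite. (Example: $G=\mathcal{G}(\mathbb{F}_q)$ a Kac–Moody group over a finite field.) A group is of type $\mathrm{FP}_n$ if there is an exact sequence $P_n\to\cdots\to P_0\to\mathbb{Z}\to0$ of finitely generated projective $\mathbb{Z}[G]$-modules. *)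

theory Defs
  imports "HOL-Algebra.Algebra" "HOL-Library.Extended_Nat"
begin

text \<open>S = {0..<n} (generator s_i is the letter i). A Coxeter matrix m has
  m i i = 1 and m i j = m j i >= 2 (possibly infinity) for i, j distinct.\<close>

definition coxeter_matrix :: "nat \<Rightarrow> (nat \<Rightarrow> nat \<Rightarrow> enat) \<Rightarrow> bool" where
  "coxeter_matrix n m \<longleftrightarrow>
     (\<forall>i<n. m i i = 1) \<and>
     (\<forall>i<n. \<forall>j<n. i \<noteq> j \<longrightarrow> m i j = m j i \<and> m i j \<ge> 2)"

fun alt_word :: "nat \<Rightarrow> nat \<Rightarrow> nat \<Rightarrow> nat list" where
  "alt_word i j 0 = []"
| "alt_word i j (Suc k) = i # alt_word j i k"

text \<open>The congruence on words over S defined by the Coxeter presentation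
  < S | s^2 = 1, (st)^m(s,t) = 1 >.\<close>
inductive cox_eq :: "nat \<Rightarrow> (nat \<Rightarrow> nat \<Rightarrow> enat) \<Rightarrow> nat list \<Rightarrow> nat list \<Rightarrow> bool"
  for n m where
  cox_refl: "cox_eq n m w w"
| cox_sym: "cox_eq n m u v \<Longrightarrow> cox_eq n m v u"
| cox_trans: "cox_eq n m u v \<Longrightarrow> cox_eq n m v w \<Longrightarrow> cox_eq n m u w"
| cox_ctxt: "cox_eq n m u v \<Longrightarrow> set x \<subseteq> {..<n} \<Longrightarrow> set y \<subseteq> {..<n}
              \<Longrightarrow> cox_eq n m (x @ u @ y) (x @ v @ y)"
| cox_inv: "i < n \<Longrightarrow> cox_eq n m [i, i] []"
| cox_braid: "i < n \<Longrightarrow> j < n \<Longrightarrow> i \<noteq> j \<Longrightarrow> m i j = enat k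
              \<Longrightarrow> cox_eq n m (alt_word i j k) (alt_word j i k)"

definition cox_cls :: "nat \<Rightarrow> (nat \<Rightarrow> nat \<Rightarrow> enat) \<Rightarrow> nat list \<Rightarrow> nat list set" where
  "cox_cls n m w = {v. set v \<subseteq> {..<n} \<and> cox_eq n m v w}"

definition coxW :: "nat \<Rightarrow> (nat \<Rightarrow> nat \<Rightarrow> enat) \<Rightarrow> nat list set set" where
  "coxW n m = {cox_cls n m w | w. set w \<subseteq> {..<n}}"

definition cox_one :: "nat \<Rightarrow> (nat \<Rightarrow> nat \<Rightarrow> enat) \<Rightarrow> nat list set" where
  "cox_one n m = cox_cls n m []"

definition cox_gen :: "nat \<Rightarrow> (nat \<Rightarrow> nat \<Rightarrow> enat) \<Rightarrow> nat \<Rightarrow> nat list set" where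
  "cox_gen n m i = cox_cls n m [i]"

definition cox_mul :: "nat \<Rightarrow> (nat \<Rightarrow> nat \<Rightarrow> enat) \<Rightarrow> nat list set \<Rightarrow> nat list set \<Rightarrow> nat list set" where
  "cox_mul n m A B = cox_cls n m ((SOME a. a \<in> A) @ (SOME b. b \<in> B))"

definition cox_inverse :: "nat \<Rightarrow> (nat \<Rightarrow> nat \<Rightarrow> enat) \<Rightarrow> nat list set \<Rightarrow> nat list set" where
  "cox_inverse n m A = cox_cls n m (rev (SOME a. a \<in> A))"

definition cox_len :: "nat \<Rightarrow> (nat \<Rightarrow> nat \<Rightarrow> enat) \<Rightarrow> nat list set \<Rightarrow> nat" where
  "cox_len n m A = (LEAST k. \<exists>w\<in>A. length w = k)"

definition spherical :: "nat \<Rightarrow> (nat \<Rightarrow> nat \<Rightarrow> enat) \<Rightarrow> nat set \<Rightarrow> bool" where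
  "spherical n m J \<longleftrightarrow> finite {cox_cls n m w | w. set w \<subseteq> J}"

definition condition_A :: "nat \<Rightarrow> (nat \<Rightarrow> nat \<Rightarrow> enat) \<Rightarrow> bool" where
  "condition_A n m \<longleftrightarrow> (\<exists>J K. J \<inter> K = {} \<and> J \<union> K = {..<n} \<and> card K \<ge> 2 \<and>
      (\<forall>s\<in>K. spherical n m (insert s J)) \<and>
      (\<forall>s\<in>K. \<forall>t\<in>K. s \<noteq> t \<longrightarrow> m s t = \<infinity>))"

section \<open>Buildings and twin buildings (W-metric approach, Abramenko-Brown)\<close>

definition building :: "nat \<Rightarrow> (nat \<Rightarrow> nat \<Rightarrow> enat) \<Rightarrow> 'c set \<Rightarrow> ('c \<Rightarrow> 'c \<Rightarrow> nat list set) \<Rightarrow> bool" where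
  "building n m C \<delta> \<longleftrightarrow>
     C \<noteq> {} \<and>
     (\<forall>x\<in>C. \<forall>y\<in>C. \<delta> x y \<in> coxW n m) \<and>
     (\<forall>x\<in>C. \<forall>y\<in>C. \<delta> x y = cox_one n m \<longleftrightarrow> x = y) \<and>
     (\<forall>x\<in>C. \<forall>y\<in>C. \<forall>z\<in>C. \<forall>i<n. \<delta> z x = cox_gen n m i \<longrightarrow>
        (\<delta> z y = cox_mul n m (cox_gen n m i) (\<delta> x y) \<or> \<delta> z y = \<delta> x y) \<and>
        (cox_len n m (cox_mul n m (cox_gen n m i) (\<delta> x y)) = cox_len n m (\<delta> x y) + 1
           \<longrightarrow> \<delta> z y = cox_mul n m (cox_gen n m i) (\<delta> x y))) \<and>
     (\<forall>x\<in>C. \<forall>y\<in>C. \<forall>i<n. \<exists>z\<in>C. \<delta> z x = cox_gen n m i \<and>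
        \<delta> z y = cox_mul n m (cox_gen n m i) (\<delta> x y))"

text \<open>Axioms (Tw2), (Tw3) for one sign: C_e, \<delta>_e, C_{-e}.\<close>
definition twin_side :: "nat \<Rightarrow> (nat \<Rightarrow> nat \<Rightarrow> enat) \<Rightarrow> 'c set \<Rightarrow> ('c \<Rightarrow> 'c \<Rightarrow> nat list set)
    \<Rightarrow> 'c set \<Rightarrow> ('c \<Rightarrow> 'c \<Rightarrow> nat list set) \<Rightarrow> bool" where
  "twin_side n m Ce \<delta>e Co \<delta>s \<longleftrightarrow>
     (\<forall>x\<in>Ce. \<forall>y\<in>Co. \<forall>z\<in>Ce. \<forall>i<n. \<delta>e z x = cox_gen n m i \<longrightarrow>
        cox_len n m (cox_mul n m (cox_gen n m i) (\<delta>s x y)) + 1 = cox_len n m (\<delta>s x y)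
        \<longrightarrow> \<delta>s z y = cox_mul n m (cox_gen n m i) (\<delta>s x y)) \<and>
     (\<forall>x\<in>Ce. \<forall>y\<in>Co. \<forall>i<n. \<exists>z\<in>Ce. \<delta>e z x = cox_gen n m i \<and>
        \<delta>s z y = cox_mul n m (cox_gen n m i) (\<delta>s x y))"

definition twin_building :: "nat \<Rightarrow> (nat \<Rightarrow> nat \<Rightarrow> enat) \<Rightarrow> 'c set \<Rightarrow> 'c set
    \<Rightarrow> ('c \<Rightarrow> 'c \<Rightarrow> nat list set) \<Rightarrow> ('c \<Rightarrow> 'c \<Rightarrow> nat list set) \<Rightarrow> ('c \<Rightarrow> 'c \<Rightarrow> nat list set) \<Rightarrow> bool" where
  "twin_building n m Cp Cm dp dm ds \<longleftrightarrow>
     Cp \<inter> Cm = {} \<and> building n m Cp dp \<and> building n m Cm dm \<and>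
     (\<forall>x\<in>Cp. \<forall>y\<in>Cm. ds x y \<in> coxW n m \<and> ds y x \<in> coxW n m) \<and>
     (\<forall>x\<in>Cp. \<forall>y\<in>Cm. ds x y = cox_inverse n m (ds y x) \<and> ds y x = cox_inverse n m (ds x y)) \<and>
     twin_side n m Cp dp Cm ds \<and> twin_side n m Cm dm Cp ds"

definition panel :: "nat \<Rightarrow> (nat \<Rightarrow> nat \<Rightarrow> enat) \<Rightarrow> 'c set \<Rightarrow> ('c \<Rightarrow> 'c \<Rightarrow> nat list set) \<Rightarrow> nat \<Rightarrow> 'c \<Rightarrow> 'c set" where
  "panel n m C \<delta> i c = {d \<in> C. \<delta> c d = cox_one n m \<or> \<delta> c d = cox_gen n m i}"

definition twin_apartment_of :: "nat \<Rightarrow> (nat \<Rightarrow> nat \<Rightarrow> enat) \<Rightarrow> 'c set \<Rightarrow> 'c set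
    \<Rightarrow> ('c \<Rightarrow> 'c \<Rightarrow> nat list set) \<Rightarrow> ('c \<Rightarrow> 'c \<Rightarrow> nat list set) \<Rightarrow> ('c \<Rightarrow> 'c \<Rightarrow> nat list set) \<Rightarrow> 'c \<Rightarrow> 'c \<Rightarrow> 'c set" where
  "twin_apartment_of n m Cp Cm dp dm ds c d =
     {x \<in> Cp. dp c x = ds d x} \<union> {y \<in> Cm. dm d y = ds c y}"

definition twin_apartment :: "nat \<Rightarrow> (nat \<Rightarrow> nat \<Rightarrow> enat) \<Rightarrow> 'c set \<Rightarrow> 'c set
    \<Rightarrow> ('c \<Rightarrow> 'c \<Rightarrow> nat list set) \<Rightarrow> ('c \<Rightarrow> 'c \<Rightarrow> nat list set) \<Rightarrow> ('c \<Rightarrow> 'c \<Rightarrow> nat list set) \<Rightarrow> 'c set \<Rightarrow> bool" where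
  "twin_apartment n m Cp Cm dp dm ds \<Sigma> \<longleftrightarrow>
     (\<exists>c\<in>Cp. \<exists>d\<in>Cm. ds c d = cox_one n m \<and> \<Sigma> = twin_apartment_of n m Cp Cm dp dm ds c d)"

definition twin_building_action :: "('g, 'b) monoid_scheme \<Rightarrow> ('g \<Rightarrow> 'c \<Rightarrow> 'c) \<Rightarrow> 'c set \<Rightarrow> 'c set
    \<Rightarrow> ('c \<Rightarrow> 'c \<Rightarrow> nat list set) \<Rightarrow> ('c \<Rightarrow> 'c \<Rightarrow> nat list set) \<Rightarrow> ('c \<Rightarrow> 'c \<Rightarrow> nat list set) \<Rightarrow> bool" where
  "twin_building_action G \<phi> Cp Cm dp dm ds \<longleftrightarrow>
     group G \<and>
     (\<forall>g\<in>carrier G. bij_betw (\<phi> g) Cp Cp \<and> bij_betw (\<phi> g) Cm Cm) \<and>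
     (\<forall>x\<in>Cp \<union> Cm. \<phi> \<one>\<^bsub>G\<^esub> x = x) \<and>
     (\<forall>g\<in>carrier G. \<forall>h\<in>carrier G. \<forall>x\<in>Cp \<union> Cm. \<phi> (g \<otimes>\<^bsub>G\<^esub> h) x = \<phi> g (\<phi> h x)) \<and>
     (\<forall>g\<in>carrier G. \<forall>x\<in>Cp. \<forall>y\<in>Cp. dp (\<phi> g x) (\<phi> g y) = dp x y) \<and>
     (\<forall>g\<in>carrier G. \<forall>x\<in>Cm. \<forall>y\<in>Cm. dm (\<phi> g x) (\<phi> g y) = dm x y) \<and>
     (\<forall>g\<in>carrier G. \<forall>x\<in>Cp. \<forall>y\<in>Cm. ds (\<phi> g x) (\<phi> g y) = ds x y \<and> ds (\<phi> g y) (\<phi> g x) = ds y x)"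

definition strongly_transitive :: "nat \<Rightarrow> (nat \<Rightarrow> nat \<Rightarrow> enat) \<Rightarrow> ('g, 'b) monoid_scheme \<Rightarrow> ('g \<Rightarrow> 'c \<Rightarrow> 'c)
    \<Rightarrow> 'c set \<Rightarrow> 'c set \<Rightarrow> ('c \<Rightarrow> 'c \<Rightarrow> nat list set) \<Rightarrow> ('c \<Rightarrow> 'c \<Rightarrow> nat list set) \<Rightarrow> ('c \<Rightarrow> 'c \<Rightarrow> nat list set) \<Rightarrow> bool" where
  "strongly_transitive n m G \<phi> Cp Cm dp dm ds \<longleftrightarrow>
     (\<forall>\<Sigma> c \<Sigma>' c'. twin_apartment n m Cp Cm dp dm ds \<Sigma> \<and> c \<in> \<Sigma> \<inter> Cp \<and>
        twin_apartment n m Cp Cm dp dm ds \<Sigma>' \<and> c' \<in> \<Sigma>' \<inter> Cp \<longrightarrow>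
        (\<exists>g\<in>carrier G. \<phi> g ` \<Sigma> = \<Sigma>' \<and> \<phi> g c = c'))"

text \<open>A (left) Z[G]-module: an abelian group M (HOL-Algebra, written
  multiplicatively) with a G-action by group endomorphisms.\<close>
definition ZG_module :: "('g, 'b) monoid_scheme \<Rightarrow> ('m, 'c) monoid_scheme \<Rightarrow> ('g \<Rightarrow> 'm \<Rightarrow> 'm) \<Rightarrow> bool" where
  "ZG_module G M a \<longleftrightarrow> group G \<and> comm_group M \<and>
     (\<forall>g\<in>carrier G. a g \<in> hom M M) \<and>
     (\<forall>x\<in>carrier M. a \<one>\<^bsub>G\<^esub> x = x) \<and>
     (\<forall>g\<in>carrier G. \<forall>h\<in>carrier G. \<forall>x\<in>carrier M. a (g \<otimes>\<^bsub>G\<^esub> h) x = a g (a h x))"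

definition ZG_hom :: "('g, 'b) monoid_scheme \<Rightarrow> ('m, 'c) monoid_scheme \<Rightarrow> ('g \<Rightarrow> 'm \<Rightarrow> 'm)
    \<Rightarrow> ('n, 'd) monoid_scheme \<Rightarrow> ('g \<Rightarrow> 'n \<Rightarrow> 'n) \<Rightarrow> ('m \<Rightarrow> 'n) \<Rightarrow> bool" where
  "ZG_hom G M a N b f \<longleftrightarrow> f \<in> hom M N \<and>
     (\<forall>g\<in>carrier G. \<forall>x\<in>carrier M. f (a g x) = b g (f x))"

definition free_ZG :: "('g, 'b) monoid_scheme \<Rightarrow> nat \<Rightarrow> ('g \<times> nat \<Rightarrow> int) monoid" where
  "free_ZG G k = \<lparr> carrier = {f. finite {p. f p \<noteq> 0} \<and>
                                 (\<forall>h i. f (h, i) \<noteq> 0 \<longrightarrow> h \<in> carrier G \<and> i < k)},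
                  monoid.mult = (\<lambda>f f' p. f p + f' p),
                  one = (\<lambda>p. 0) \<rparr>"

definition free_ZG_act :: "('g, 'b) monoid_scheme \<Rightarrow> 'g \<Rightarrow> ('g \<times> nat \<Rightarrow> int) \<Rightarrow> ('g \<times> nat \<Rightarrow> int)" where
  "free_ZG_act G g f = (\<lambda>(h, i). if h \<in> carrier G then f (inv\<^bsub>G\<^esub> g \<otimes>\<^bsub>G\<^esub> h, i) else 0)"

definition fin_gen_ZG_module :: "('g, 'b) monoid_scheme \<Rightarrow> ('m, 'c) monoid_scheme \<Rightarrow> ('g \<Rightarrow> 'm \<Rightarrow> 'm) \<Rightarrow> bool" where
  "fin_gen_ZG_module G M a \<longleftrightarrow> ZG_module G M a \<and>
     (\<exists>Xg. finite Xg \<and> Xg \<subseteq> carrier M \<and>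
          generate M {a g x | g x. g \<in> carrier G \<and> x \<in> Xg} = carrier M)"

definition fg_projective :: "('g, 'b) monoid_scheme \<Rightarrow> ('m, 'c) monoid_scheme \<Rightarrow> ('g \<Rightarrow> 'm \<Rightarrow> 'm) \<Rightarrow> bool" where
  "fg_projective G P a \<longleftrightarrow> fin_gen_ZG_module G P a \<and>
     (\<exists>k i p. ZG_hom G P a (free_ZG G k) (free_ZG_act G) i \<and>
             ZG_hom G (free_ZG G k) (free_ZG_act G) P a p \<and>
             (\<forall>x\<in>carrier P. p (i x) = x))"

text \<open>Type FP_2 (with the modules P_0, P_1, P_2 taken in the type 'm):
  an exact sequence P_2 \<rightarrow> P_1 \<rightarrow> P_0 \<rightarrow> Z \<rightarrow> 0 of finitely generated projective
  Z[G]-modules, Z carrying the trivial action.\<close>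
definition FP2_in :: "'m itself \<Rightarrow> ('g, 'b) monoid_scheme \<Rightarrow> bool" where
  "FP2_in _ G \<longleftrightarrow>
     (\<exists>(P0 :: 'm monoid) a0 (P1 :: 'm monoid) a1 (P2 :: 'm monoid) a2 d1 d2 (\<epsilon> :: 'm \<Rightarrow> int).
        fg_projective G P0 a0 \<and> fg_projective G P1 a1 \<and> fg_projective G P2 a2 \<and>
        ZG_hom G P1 a1 P0 a0 d1 \<and> ZG_hom G P2 a2 P1 a1 d2 \<and>
        (\<forall>x\<in>carrier P0. \<forall>y\<in>carrier P0. \<epsilon> (x \<otimes>\<^bsub>P0\<^esub> y) = \<epsilon> x + \<epsilon> y) \<and>
        (\<forall>g\<in>carrier G. \<forall>x\<in>carrier P0. \<epsilon> (a0 g x) = \<epsilon> x) \<and>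
        (\<forall>z. \<exists>x\<in>carrier P0. \<epsilon> x = z) \<and>
        {x \<in> carrier P0. \<epsilon> x = 0} = d1 ` carrier P1 \<and>
        {x \<in> carrier P1. d1 x = \<one>\<^bsub>P0\<^esub>} = d2 ` carrier P2)"

definition eval_word :: "('g, 'b) monoid_scheme \<Rightarrow> ('g \<times> bool) list \<Rightarrow> 'g" where
  "eval_word G w = foldr (\<lambda>(x, b) acc. (if b then x else inv\<^bsub>G\<^esub> x) \<otimes>\<^bsub>G\<^esub> acc) w \<one>\<^bsub>G\<^esub>"

inductive pres_eq :: "'g set \<Rightarrow> ('g \<times> bool) list set \<Rightarrow> ('g \<times> bool) list \<Rightarrow> ('g \<times> bool) list \<Rightarrow> bool"
  for Xg R where
  pres_refl: "pres_eq Xg R w w"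
| pres_sym: "pres_eq Xg R u v \<Longrightarrow> pres_eq Xg R v u"
| pres_trans: "pres_eq Xg R u v \<Longrightarrow> pres_eq Xg R v w \<Longrightarrow> pres_eq Xg R u w"
| pres_free: "x \<in> Xg \<Longrightarrow> pres_eq Xg R (u @ [(x, b), (x, \<not> b)] @ v) (u @ v)"
| pres_rel: "r \<in> R \<Longrightarrow> pres_eq Xg R (u @ r @ v) (u @ v)"

definition finitely_presented :: "('g, 'b) monoid_scheme \<Rightarrow> bool" where
  "finitely_presented G \<longleftrightarrow>
     (\<exists>Xg R. finite Xg \<and> Xg \<subseteq> carrier G \<and> generate G Xg = carrier G \<and> finite R \<and>
        (\<forall>r\<in>R. set r \<subseteq> Xg \<times> UNIV \<and> eval_word G r = \<one>\<^bsub>G\<^esub>) \<and>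
        (\<forall>w. set w \<subseteq> Xg \<times> UNIV \<and> eval_word G w = \<one>\<^bsub>G\<^esub> \<longrightarrow> pres_eq Xg R w []))"

end

theory Submission
  imports Defs Complex_Main
begin

text \<open>Condition (A) makes \<open>W\<close> split as a free product with amalgamation over the finite group
  \<open>W\<^sub>J\<close>, so both halves of the twin building look like trees: the indicator function of a
  half-tree changes only near one \<open>J\<close>-residue. Choose such functions \<open>h\<close> on the
  positive and \<open>k\<close> on the negative half, based at residues of codistance about \<open>L\<close>, and put
  \<open>\<omega>(a, b) = h(a c\<^sub>0) (k(b d\<^sub>0) - k(a d\<^sub>0))\<close> on \<open>G \<times> G\<close>. The coboundary of \<open>\<omega>\<close> is the cup product
  \<open>(h(b c\<^sub>0) - h(a c\<^sub>0)) (k(c d\<^sub>0) - k(b d\<^sub>0))\<close>; it vanishes on triples of bounded size once \<open>L\<close> is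
  large, because \<open>b c\<^sub>0\<close> and \<open>b d\<^sub>0\<close> are opposite. On the other hand thickness provides a diamond of
  opposite pairs of chambers around a pair of codistance \<open>L\<close>, hence a loop in \<open>G\<close> with steps in a
  finite set that does not depend on \<open>L\<close>, and \<open>\<omega>\<close> sums to 1 along it. If \<open>G\<close> were finitely
  presented or of type FP2, all such loops would bound chains of bounded size, and the sum would
  be 0.\<close>

section \<open>Words in a Coxeter group\<close>

text \<open>\<open>\<omega>\<close> imitates the form h dk on a product of two trees: its integral
  along a loop counts the winding around the point where both functions jump, and dh dk sits at that
  point only. Opposite pairs of chambers, on which \<open>G\<close> is transitive with finite
  stabilizers, keep away from it when the base chambers have large codistance; so a loop of short
  steps surrounds a hole of size about \<open>L\<close>. The order of choices is essential: the step
  set \<open>A\<close>, finite because panels and \<open>T\<close> are finite; then the set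
  \<open>F\<close> that the finiteness property attaches to \<open>A\<close>; only then
  \<open>L\<close>, large compared with displacements under \<open>F\<close>. Both finiteness
  properties are weakened to one statement on integral cochains, \<open>loops_fill\<close>, so no
  space has to be built. Likewise the tree of the splitting is never constructed: it is seen through
  integer functions on words that respect the Coxeter relations. They show that alternating words in
  two letters of \<open>K\<close> are reduced, and they define the half-trees. Their input, that
  such words leave \<open>W_J\<close>, comes from a linear action of \<open>W\<close>.\<close>

lemma length_alt_word [simp]: "length (alt_word i j k) = k"
  by (induction i j k rule: alt_word.induct) auto

lemma set_alt_word: "set (alt_word i j k) \<subseteq> {i, j}"
  by (induction i j k rule: alt_word.induct) auto

lemma alt_word_snoc: "alt_word i j (Suc k) = alt_word i j k @ [if even k then i else j]"
  by (induction i j k rule: alt_word.induct) auto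

lemma rev_alt_word: "rev (alt_word i j k) = (if even k then alt_word j i k else alt_word i j k)"
proof (induction k arbitrary: i j)
  case (Suc k)
  show ?case
    by (subst alt_word_snoc) (use Suc in auto)
qed auto

locale coxeter =
  fixes n :: nat and m :: "nat \<Rightarrow> nat \<Rightarrow> enat"
  assumes cox: "coxeter_matrix n m"
begin

abbreviation ceq (infix "\<doteq>" 50) where "u \<doteq> v \<equiv> cox_eq n m u v"
abbreviation "wrd w \<equiv> set w \<subseteq> {..<n}"
abbreviation "cls w \<equiv> cox_cls n m w"
abbreviation "len A \<equiv> cox_len n m A"

lemma ceq_wrd: "u \<doteq> v \<Longrightarrow> wrd u \<longleftrightarrow> wrd v"
proof (induction rule: cox_eq.induct)
  case (cox_braid i j k)
  then show ?case
    using set_alt_word[of i j k] set_alt_word[of j i k] by auto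
qed auto

lemma ceq_app: "u \<doteq> v \<Longrightarrow> wrd y \<Longrightarrow> u @ y \<doteq> v @ y"
  using cox_ctxt[of n m u v "[]" y] by simp

lemma ceq_pre: "u \<doteq> v \<Longrightarrow> wrd y \<Longrightarrow> y @ u \<doteq> y @ v"
  using cox_ctxt[of n m u v y "[]"] by simp

lemma ceq_cons: "u \<doteq> v \<Longrightarrow> i < n \<Longrightarrow> i # u \<doteq> i # v"
  using ceq_pre[of u v "[i]"] by simp

lemma ceq_app2: "u \<doteq> v \<Longrightarrow> u' \<doteq> v' \<Longrightarrow> wrd u' \<Longrightarrow> wrd v \<Longrightarrow> u @ u' \<doteq> v @ v'"
  using ceq_app[of u v u'] ceq_pre[of u' v' v] cox_trans by blast

lemma ceq_cancel2: "i < n \<Longrightarrow> wrd w \<Longrightarrow> i # i # w \<doteq> w"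
  using ceq_app[OF cox_inv[of i n m], of w] by simp

lemma ceq_rev_inv: "wrd w \<Longrightarrow> w @ rev w \<doteq> []"
proof (induction w)
  case Nil
  then show ?case by (simp add: cox_refl)
next
  case (Cons i w)
  have "i # (w @ rev w) @ [i] \<doteq> i # [] @ [i]"
    using Cons cox_ctxt[of n m "w @ rev w" "[]" "[i]" "[i]"] by simp
  moreover have "i # [] @ [i] \<doteq> []"
    using Cons cox_inv[of i n m] by simp
  ultimately show ?case using cox_trans[of n m _ "i # [] @ [i]"] by simp
qed

lemma ceq_rev: "u \<doteq> v \<Longrightarrow> rev u \<doteq> rev v"
proof (induction rule: cox_eq.induct)
  case (cox_ctxt u v x y)
  then show ?case using cox_eq.cox_ctxt[of n m "rev u" "rev v" "rev y" "rev x"] by simp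
next
  case (cox_braid i j k)
  then show ?case
    using cox_eq.cox_braid[of i n j m k] by (auto simp: rev_alt_word intro: cox_eq.cox_sym)
qed (auto intro: cox_eq.intros)

lemma ceq_parity: "u \<doteq> v \<Longrightarrow> even (length u) \<longleftrightarrow> even (length v)"
  by (induction rule: cox_eq.induct) auto

lemma mem_cls: "v \<in> cls w \<longleftrightarrow> wrd v \<and> v \<doteq> w"
  by (simp add: cox_cls_def)

lemma cls_eq: "wrd u \<Longrightarrow> cls u = cls v \<longleftrightarrow> u \<doteq> v"
  unfolding cox_cls_def by (auto intro: cox_eq.intros)

lemma some_cls: "wrd w \<Longrightarrow> wrd (SOME a. a \<in> cls w) \<and> (SOME a. a \<in> cls w) \<doteq> w"
  using someI[of "\<lambda>a. a \<in> cls w" w] by (simp add: mem_cls cox_refl)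

lemma mul_cls: "wrd u \<Longrightarrow> wrd v \<Longrightarrow> cox_mul n m (cls u) (cls v) = cls (u @ v)"
  unfolding cox_mul_def
  using some_cls[of u] some_cls[of v] by (subst cls_eq) (auto intro: ceq_app2)

lemma gen_mul: "i < n \<Longrightarrow> wrd v \<Longrightarrow> cox_mul n m (cox_gen n m i) (cls v) = cls (i # v)"
  unfolding cox_gen_def using mul_cls[of "[i]" v] by simp

lemma inverse_cls: "wrd u \<Longrightarrow> cox_inverse n m (cls u) = cls (rev u)"
  unfolding cox_inverse_def
  using some_cls[of u] by (subst cls_eq) (auto intro: ceq_rev)

lemma coxW_iff: "A \<in> coxW n m \<longleftrightarrow> (\<exists>w. wrd w \<and> A = cls w)"
  unfolding coxW_def by auto

lemma len_ex: "wrd w \<Longrightarrow> \<exists>v. wrd v \<and> v \<doteq> w \<and> length v = len (cls w)"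
proof -
  assume "wrd w"
  then have "w \<in> cls w" by (simp add: mem_cls cox_refl)
  then have "\<exists>v\<in>cls w. length v = (LEAST k. \<exists>v\<in>cls w. length v = k)"
    using LeastI_ex[of "\<lambda>k. \<exists>v\<in>cls w. length v = k"] by blast
  then show ?thesis unfolding cox_len_def using mem_cls by metis
qed

lemma len_le: "wrd v \<Longrightarrow> v \<doteq> w \<Longrightarrow> len (cls w) \<le> length v"
  unfolding cox_len_def by (rule Least_le) (auto simp: mem_cls)

lemma len_parity: "wrd w \<Longrightarrow> even (len (cls w)) \<longleftrightarrow> even (length w)"
  using len_ex[of w] ceq_parity by metis

lemma len_cons_le: "i < n \<Longrightarrow> wrd w \<Longrightarrow> len (cls (i # w)) \<le> len (cls w) + 1"
proof -
  assume i: "i < n" and w: "wrd w"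
  obtain v where v: "wrd v" "v \<doteq> w" "length v = len (cls w)" using len_ex[OF w] by blast
  have "len (cls (i # w)) \<le> length (i # v)"
    by (rule len_le) (use i v ceq_cons in auto)
  then show ?thesis using v by simp
qed

text \<open>Both sides of every defining relation have lengths of the same parity, so the two values
  cannot agree; \<open>len_cons_le\<close>, applied to \<open>w\<close> and to \<open>i # w\<close>,
  leaves only the two neighbours.\<close>

lemma len_cons_cases:
  assumes "i < n" "wrd w"
  shows "len (cls (i # w)) = len (cls w) + 1 \<or> len (cls (i # w)) + 1 = len (cls w)"
proof -
  have "len (cls w) = len (cls (i # i # w))"
    using cls_eq[of "i # i # w" w] ceq_cancel2[of i w] assms by simp
  also have "\<dots> \<le> len (cls (i # w)) + 1" using assms by (intro len_cons_le) auto
  finally have 1: "len (cls w) \<le> len (cls (i # w)) + 1" .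
  have 2: "len (cls (i # w)) \<le> len (cls w) + 1" using assms len_cons_le by auto
  have "even (len (cls (i # w))) \<noteq> even (len (cls w))"
    using assms len_parity[of w] len_parity[of "i # w"] by simp
  then have "len (cls (i # w)) \<noteq> len (cls w)" by auto
  then show ?thesis using 1 2 by linarith
qed

lemma len_Nil [simp]: "len (cls []) = 0"
  using len_le[of "[]" "[]"] cox_refl by auto

lemma len_rev: "wrd w \<Longrightarrow> len (cls (rev w)) = len (cls w)"
proof -
  have "len (cls (rev u)) \<le> len (cls u)" if u: "wrd u" for u
  proof -
    obtain v where v: "wrd v" "v \<doteq> u" "length v = len (cls u)" using len_ex[OF u] by blast
    then show ?thesis using len_le[of "rev v" "rev u"] ceq_rev by auto
  qed
  from this[of w] this[of "rev w"] show "wrd w \<Longrightarrow> ?thesis" by auto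
qed

lemma one_neq_gen: "i < n \<Longrightarrow> cox_gen n m i \<noteq> cox_one n m"
  unfolding cox_gen_def cox_one_def using cls_eq[of "[i]" "[]"] ceq_parity[of "[i]" "[]"] by auto

subsection \<open>The numbers game\<close>

text \<open>The dual of the reflection representation: \<open>fire i\<close> adds \<open>x i\<close> times the
  \<open>i\<close>-th row of the negated Cartan matrix.  The diagonal entry is \<open>2 * cos pi = - 2\<close>.\<close>

definition cartan :: "nat \<Rightarrow> nat \<Rightarrow> real" where
  "cartan i j = (case m i j of enat k \<Rightarrow> 2 * cos (pi / real k) | \<infinity> \<Rightarrow> 2)"

definition fire :: "nat \<Rightarrow> (nat \<Rightarrow> real) \<Rightarrow> nat \<Rightarrow> real" where
  "fire i x = (\<lambda>p. x p + x i * cartan i p)"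

text \<open>Chebyshev polynomials of the second kind, index shifted by one: for
  \<open>c = 2 * cos t\<close> this is \<open>sin (k * t) / sin t\<close>. When \<open>i\<close> and
  \<open>j\<close> are fired in turn with \<open>cartan i j = c\<close>, the \<open>k\<close>-th
  firing releases \<open>x i * cheb c k + x j * cheb c (k - 1)\<close>.\<close>

fun cheb :: "real \<Rightarrow> nat \<Rightarrow> real" where
  "cheb c 0 = 0"
| "cheb c (Suc 0) = 1"
| "cheb c (Suc (Suc k)) = c * cheb c (Suc k) - cheb c k"

text \<open>Splitting the sum of \<open>cheb\<close> by parity of the index separates what
  \<open>i\<close> releases (firings 1, 3, ...) from what \<open>j\<close> releases (firings 2, 4,
  ...).\<close>

fun oddsum :: "real \<Rightarrow> nat \<Rightarrow> real" where
  "oddsum c 0 = 0"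
| "oddsum c (Suc k) = oddsum c k + (if odd k then cheb c k else 0)"

fun evensum :: "real \<Rightarrow> nat \<Rightarrow> real" where
  "evensum c 0 = 0"
| "evensum c (Suc k) = evensum c k + (if even k then cheb c k else 0)"

lemma cheb_sums:
  "oddsum c (Suc (Suc k)) = 1 + c * evensum c (Suc k) - oddsum c k"
  "evensum c (Suc (Suc k)) = c * oddsum c (Suc k) - evensum c k"
proof (induction k)
  case (Suc k)
  { case 1 show ?case using Suc by (auto simp: algebra_simps) }
  { case 2 show ?case using Suc by (auto simp: algebra_simps) }
qed auto

lemma fold_fire_alt:
  assumes "cartan i i = - 2" "cartan j j = - 2" "cartan i j = c" "cartan j i = c"
  shows "fold fire (alt_word i j k) x = (\<lambda>p. x p
    + (x i * oddsum c (Suc k) + x j * evensum c k) * cartan i p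
    + (x i * evensum c (Suc k) + x j * oddsum c k) * cartan j p)"
  using assms
proof (induction k arbitrary: i j x)
  case (Suc k)
  have IH: "fold fire (alt_word j i k) (fire i x) = (\<lambda>p. fire i x p
    + (fire i x j * oddsum c (Suc k) + fire i x i * evensum c k) * cartan j p
    + (fire i x j * evensum c (Suc k) + fire i x i * oddsum c k) * cartan i p)"
    using Suc.prems by (intro Suc.IH) auto
  have f: "fire i x j = x j + c * x i" "fire i x i = - x i"
    using Suc.prems by (simp_all add: fire_def)
  show ?case
    unfolding alt_word.simps fold_simps IH f cheb_sums
    by (simp only: fire_def) (simp add: algebra_simps)
qed auto

lemma cheb_sin: "sin t * cheb (2 * cos t) k = sin (real k * t)"
proof (induction k rule: induct_nat_012)
  case (ge2 k)
  have "sin (real (Suc (Suc k)) * t) + sin (real k * t) = 2 * cos t * sin (real (Suc k) * t)"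
    using sin_plus_sin[of "real (Suc (Suc k)) * t" "real k * t"]
    by (simp add: algebra_simps add_divide_distrib)
  then show ?case using ge2 by (simp add: algebra_simps)
qed auto

lemma cheb_2: "cheb 2 k = real k"
  by (induction k rule: induct_nat_012) auto

lemma cartan_diag: "i < n \<Longrightarrow> cartan i i = - 2"
  using cox by (simp add: cartan_def coxeter_matrix_def one_enat_def)

lemma cartan_sym: "i < n \<Longrightarrow> j < n \<Longrightarrow> cartan i j = cartan j i"
  using cox unfolding cartan_def coxeter_matrix_def by metis

text \<open>The two sides differ by multiples of \<open>cheb c k\<close>, which is
  \<open>sin pi / sin (pi / k) = 0\<close>; \<open>k \<ge> 2\<close> keeps the denominator
  nonzero.\<close>

lemma fire_braid:
  assumes ij: "i < n" "j < n" "i \<noteq> j" and k: "m i j = enat k"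
  shows "fold fire (alt_word i j k) = fold fire (alt_word j i k)"
proof
  fix x
  define c where "c = cartan i j"
  have c: "cartan i j = c" "cartan j i = c" using ij cartan_sym by (auto simp: c_def)
  have "m i j \<ge> 2" using cox ij unfolding coxeter_matrix_def by blast
  then have k2: "k \<ge> 2" using k by (simp add: numeral_eq_enat)
  have "c = 2 * cos (pi / real k)" using k by (simp add: c_def cartan_def)
  moreover have "sin (pi / real k) \<noteq> 0"
    using k2 sin_gt_zero[of "pi / real k"] by (simp add: field_simps)
  ultimately have "cheb c k = 0" using cheb_sin[of "pi / real k" k] k2 by simp
  then show "fold fire (alt_word i j k) x = fold fire (alt_word j i k) x"
    using fold_fire_alt[of i j c k x] fold_fire_alt[of j i c k x] ij c cartan_diag
    by (simp add: algebra_simps)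
qed

text \<open>So \<open>fold fire\<close> depends only on the element of \<open>W\<close>, which gives
  a way to prove that two words are not congruent.\<close>

lemma fold_fire_ceq: "u \<doteq> v \<Longrightarrow> fold fire u = fold fire v"
proof (induction rule: cox_eq.induct)
  case (cox_inv i)
  then show ?case by (auto simp: fire_def cartan_diag)
next
  case (cox_braid i j k)
  then show ?case by (rule fire_braid)
qed auto

lemma fold_fire_fixed: "(\<And>j. j \<in> set w \<Longrightarrow> x j = 0) \<Longrightarrow> fold fire w x = x"
  by (induction w) (auto simp: fire_def)

text \<open>Here \<open>cartan s t = 2\<close>, the limit of \<open>2 * cos (pi / k)\<close>, and
  \<open>cheb 2 k = k\<close>; the label of \<open>s\<close> changes by \<open>2 * k\<close> up to
  sign.\<close>

lemma fold_fire_free_alt: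
  assumes "s < n" "t < n" "s \<noteq> t" "m s t = \<infinity>" "k \<ge> 1"
  shows "fold fire (alt_word s t k) (\<lambda>p. if p \<in> {s, t} then 1 else 0) \<noteq> (\<lambda>p. if p \<in> {s, t} then 1 else 0)"
proof -
  have "cartan s t = 2" using assms by (simp add: cartan_def)
  then show ?thesis
    using assms fold_fire_alt[of s t 2 k "\<lambda>p. if p \<in> {s, t} then 1 else 0"]
      cartan_sym[of s t] cartan_diag[of s] cartan_diag[of t]
    by (auto simp: fun_eq_iff cheb_2 intro!: exI[of _ s])
qed

end

section \<open>Coxeter groups that split over a finite parabolic subgroup\<close>

locale split_coxeter = coxeter +
  fixes J K :: "nat set"
  assumes JK: "J \<inter> K = {}" "J \<union> K = {..<n}"
    and K_free: "\<And>s t. s \<in> K \<Longrightarrow> t \<in> K \<Longrightarrow> s \<noteq> t \<Longrightarrow> m s t = \<infinity>"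
    and K_ne: "K \<noteq> {}"
    and J_spherical: "spherical n m J"
begin

definition inJ :: "nat list \<Rightarrow> bool" where
  "inJ w \<longleftrightarrow> (\<exists>v. set v \<subseteq> J \<and> w \<doteq> v)"

lemma J_lt: "i \<in> J \<Longrightarrow> i < n" and K_lt: "i \<in> K \<Longrightarrow> i < n"
  using JK by auto

lemma inJ_ceq: "u \<doteq> v \<Longrightarrow> inJ u \<longleftrightarrow> inJ v"
  unfolding inJ_def by (meson cox_sym cox_trans)

lemma inJ_Nil [simp]: "inJ []"
  unfolding inJ_def using cox_refl by (intro exI[of _ "[]"]) auto

lemma inJ_wrd: "inJ w \<Longrightarrow> wrd w"
  unfolding inJ_def using ceq_wrd J_lt by blast

lemma inJ_cons: assumes "u \<in> J" shows "inJ (u # w) \<longleftrightarrow> inJ w"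
proof -
  have 1: "inJ (u # w)" if "inJ w" for w
  proof -
    from that obtain v where "set v \<subseteq> J" "w \<doteq> v" unfolding inJ_def by blast
    then have "set (u # v) \<subseteq> J" "u # w \<doteq> u # v" using assms J_lt ceq_cons by auto
    then show ?thesis unfolding inJ_def by blast
  qed
  show ?thesis
  proof
    assume a: "inJ (u # w)"
    then have "u # u # w \<doteq> w" using inJ_wrd[of "u # w"] ceq_cancel2[of u w] by simp
    then show "inJ w" using 1[OF a] inJ_ceq by blast
  qed (rule 1)
qed

lemma inJ_rev: "inJ w \<Longrightarrow> inJ (rev w)"
  unfolding inJ_def using ceq_rev by (metis set_rev)

text \<open>Every defining relation only involves letters of \<open>J \<union> {s}\<close> for a single \<open>s \<in> K\<close>,
  and on such letters the increments below are those of \<open>- \<kappa> (_) s\<close>.\<close>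

fun pot :: "(nat list \<Rightarrow> nat \<Rightarrow> int) \<Rightarrow> nat list \<Rightarrow> int" where
  "pot \<kappa> [] = 0"
| "pot \<kappa> (u # w) = pot \<kappa> w + (if u \<in> K then \<kappa> w u - \<kappa> (u # w) u else 0)"

text \<open>In the Bass-Serre tree of the splitting, \<open>\<kappa> w s\<close> is a weight on the
  edge from the coset \<open>W_J w\<close> to the coset of \<open>w\<close> under the subgroup
  generated by \<open>J\<close> and \<open>s\<close>. \<open>pot \<kappa>\<close> integrates these
  weights: a letter \<open>s\<close> goes up one such edge and down another.\<close>

definition cut_function :: "(nat list \<Rightarrow> nat \<Rightarrow> int) \<Rightarrow> bool" where
  "cut_function \<kappa> \<longleftrightarrow> (\<forall>s u v. u \<doteq> v \<longrightarrow> \<kappa> u s = \<kappa> v s) \<and>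
     (\<forall>s\<in>K. \<forall>u\<in>J. \<forall>w. wrd w \<longrightarrow> \<kappa> (u # w) s = \<kappa> w s)"

lemma pot_local:
  assumes \<kappa>: "cut_function \<kappa>" and s: "s \<in> K" and z: "set z \<subseteq> insert s J" and y: "wrd y"
  shows "pot \<kappa> (z @ y) = pot \<kappa> y + \<kappa> y s - \<kappa> (z @ y) s"
  using z
proof (induction z)
  case (Cons u z)
  have "wrd (z @ y)" using Cons y s J_lt K_lt by auto
  then show ?case using Cons JK s \<kappa> unfolding cut_function_def by (cases "u = s") auto
qed auto

lemma pot_relation:
  assumes \<kappa>: "cut_function \<kappa>" and s: "s \<in> K"
    and z: "set z \<subseteq> insert s J" "set z' \<subseteq> insert s J" "z \<doteq> z'" and y: "wrd y"
  shows "pot \<kappa> (z @ y) = pot \<kappa> (z' @ y)"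
proof -
  have "\<kappa> (z @ y) s = \<kappa> (z' @ y) s"
    using \<kappa> ceq_app[OF z(3) y] unfolding cut_function_def by blast
  then show ?thesis using pot_local[OF \<kappa> s _ y] z by simp
qed

text \<open>Independence of the path, as on a tree. A word \<open>y\<close> to the right of a
  relation only shifts the formula of \<open>pot_local\<close> by a constant. For letters to the
  left, \<open>pre\<close> applies: their increments depend only on the class of the word that
  follows.\<close>

lemma pot_ceq:
  assumes \<kappa>: "cut_function \<kappa>"
  shows "u \<doteq> v \<Longrightarrow> pot \<kappa> u = pot \<kappa> v"
proof -
  have pre: "pot \<kappa> (x @ u) = pot \<kappa> (x @ v)"
    if "u \<doteq> v" "pot \<kappa> u = pot \<kappa> v" "wrd x" for x u v
    using that(3)
  proof (induction x)
    case (Cons i x)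
    have "x @ u \<doteq> x @ v" "i # x @ u \<doteq> i # x @ v"
      using ceq_pre[OF that(1), of x] ceq_pre[OF that(1), of "i # x"] Cons by auto
    then have "\<kappa> (x @ u) i = \<kappa> (x @ v) i" "\<kappa> (i # x @ u) i = \<kappa> (i # x @ v) i"
      using \<kappa> unfolding cut_function_def by blast+
    then show ?case using Cons by simp
  qed (use that in auto)
  have "pot \<kappa> (u @ y) = pot \<kappa> (v @ y)" if "u \<doteq> v" "wrd y" for u v y
    using that
  proof (induction arbitrary: y rule: cox_eq.induct)
    case (cox_ctxt u v x y')
    have yy: "wrd (y' @ y)" using cox_ctxt.hyps cox_ctxt.prems by simp
    have "pot \<kappa> (x @ u @ y' @ y) = pot \<kappa> (x @ v @ y' @ y)"
      by (rule pre[OF ceq_app[OF cox_ctxt.hyps(1) yy] cox_ctxt.IH[OF yy] cox_ctxt.hyps(2)])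
    then show ?case by simp
  next
    case (cox_inv i)
    then have "i \<in> J \<union> K" using JK by auto
    then obtain s where "s \<in> K" "i \<in> insert s J" using K_ne by blast
    then show ?case
      using pot_relation[OF \<kappa>, of s "[i, i]" "[]" y] cox_inv cox_eq.cox_inv by simp
  next
    case (cox_braid i j k)
    have "\<not> (i \<in> K \<and> j \<in> K)" using K_free[of i j] cox_braid.hyps by auto
    moreover have "i \<in> J \<union> K" "j \<in> J \<union> K" using JK cox_braid.hyps by auto
    ultimately obtain s where s: "s \<in> K" "{i, j} \<subseteq> insert s J"
      using K_ne by blast
    have "alt_word i j k \<doteq> alt_word j i k" using cox_braid cox_eq.cox_braid by blast
    then show ?case
      using pot_relation[OF \<kappa> s(1), of "alt_word i j k" "alt_word j i k" y] cox_braid.prems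
        s(2) set_alt_word[of i j k] set_alt_word[of j i k] by auto
  next
    case (cox_sym u v)
    show ?case by (rule cox_sym.IH[OF cox_sym.prems, symmetric])
  next
    case (cox_trans u v w)
    show ?case by (rule trans[OF cox_trans.IH(1)[OF cox_trans.prems] cox_trans.IH(2)[OF cox_trans.prems]])
  qed simp
  from this[of u v "[]"] show "u \<doteq> v \<Longrightarrow> ?thesis" by simp
qed

text \<open>The labelling that is 1 on \<open>s\<close> and \<open>t\<close> and 0 elsewhere is
  fixed by words over \<open>J\<close>, which only fire zeros, and is moved by alternating words
  over \<open>s\<close> and \<open>t\<close>.\<close>

lemma alt_not_inJ:
  assumes "s \<in> K" "t \<in> K" "s \<noteq> t" "k \<ge> 1"
  shows "\<not> inJ (alt_word s t k)"
proof
  let ?x = "\<lambda>p. if p \<in> {s, t} then 1 else 0 :: real"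
  assume "inJ (alt_word s t k)"
  then obtain v where v: "set v \<subseteq> J" "alt_word s t k \<doteq> v" unfolding inJ_def by blast
  have "fold fire v ?x = ?x" using v JK assms by (intro fold_fire_fixed) auto
  then show False
    using fold_fire_ceq[OF v(2)] fold_fire_free_alt[of s t k] assms K_lt K_free by metis
qed

lemma J_len_bounded: "\<exists>M. \<forall>w. inJ w \<longrightarrow> len (cls w) \<le> M"
proof -
  have "finite (len ` {cls w | w. set w \<subseteq> J})"
    using J_spherical unfolding spherical_def by blast
  then obtain M where M: "\<And>w. set w \<subseteq> J \<Longrightarrow> len (cls w) \<le> M"
    unfolding finite_nat_set_iff_bounded_le by blast
  have "len (cls w) \<le> M" if "inJ w" for w
    using that M inJ_wrd[OF that] cls_eq[of w] unfolding inJ_def by metis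
  then show ?thesis by blast
qed

end

locale split_pair = split_coxeter +
  fixes s t :: nat
  assumes st: "s \<in> K" "t \<in> K" "s \<noteq> t"
begin

definition letter :: "nat \<Rightarrow> nat" where "letter a = (if even a then s else t)"

text \<open>Galleries lengthen Weyl distances to a fixed chamber on the left, so the rightmost letter
  \<open>letter (Suc e)\<close> of these words does not depend on \<open>a\<close>.\<close>

definition altw :: "nat \<Rightarrow> nat \<Rightarrow> nat list" where
  "altw e a = alt_word (letter (e + a)) (letter (Suc (e + a))) a"

lemma letter_simps [simp]: "letter (Suc (Suc a)) = letter a" "letter 0 = s" "letter (Suc 0) = t"
  by (auto simp: letter_def)

lemma letter_K: "letter a \<in> K" and letter_lt: "letter a < n"
  using st K_lt by (auto simp: letter_def)

lemma letter_neq: "letter a = letter b \<longleftrightarrow> (even a \<longleftrightarrow> even b)"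
  using st by (auto simp: letter_def)

lemma altw_0 [simp]: "altw e 0 = []" by (simp add: altw_def)

lemma altw_Suc: "altw e (Suc a) = letter (e + Suc a) # altw e a"
  by (simp add: altw_def)

lemma wrd_alt: "wrd (alt_word (letter a) (letter b) k)"
  using set_alt_word[of "letter a" "letter b" k] letter_lt by auto

lemma wrd_altw: "wrd (altw e a)"
  unfolding altw_def by (rule wrd_alt)

lemma altw_not_inJ: "a \<ge> 1 \<Longrightarrow> \<not> inJ (altw e a)"
  unfolding altw_def using letter_K letter_neq by (intro alt_not_inJ) auto

lemma altw_add: "altw e (b + a) = altw (e + a) b @ altw e a"
proof (induction b)
  case (Suc b)
  show ?case using Suc by (simp add: altw_Suc ac_simps)
qed simp

text \<open>The common right end cancels and leaves, up to inversion, an alternating word of length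
  \<open>|a - b|\<close>. Hence the \<open>altw e a\<close> lie in different cosets of
  \<open>W_J\<close>: their path in the tree never returns.\<close>

lemma altw_rev_inJ:
  assumes "inJ (altw e a @ rev (altw e b))"
  shows "a = b"
proof -
  have *: "inJ (altw (e + b) c)" if "inJ (altw e (c + b) @ rev (altw e b))" for b c
  proof -
    have "altw (e + b) c @ (altw e b @ rev (altw e b)) \<doteq> altw (e + b) c @ []"
      using ceq_rev_inv[OF wrd_altw] wrd_altw ceq_pre by blast
    then show ?thesis using that inJ_ceq by (simp add: altw_add)
  qed
  show ?thesis
  proof (cases a b rule: linorder_cases)
    case less
    then show ?thesis
      using inJ_rev[OF assms] *[of "b - a" a] altw_not_inJ[of "b - a" "e + a"] by simp
  next
    case greater
    then show ?thesis
      using assms *[of "a - b" b] altw_not_inJ[of "a - b" "e + b"] by simp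
  qed
qed

text \<open>The potential below is a 1-Lipschitz Busemann function growing by one along \<open>altw e\<close>.\<close>

lemma len_altw: "len (cls (altw e a)) = a"
proof -
  \<comment> \<open>Weight 1 goes to the edges at the coset of \<open>altw e k\<close> except the
    one of type \<open>letter (e + k)\<close>, by which the path arrives. A step along the path then
    contributes \<open>1 - 0\<close>, and no step contributes more.\<close>
  define \<kappa> :: "nat list \<Rightarrow> nat \<Rightarrow> int" where
    "\<kappa> w u = (if \<exists>k. inJ (w @ rev (altw e k)) \<and> u \<noteq> letter (e + k) then 1 else 0)" for w u
  have wr: "wrd (rev (altw e k))" for k using wrd_altw by simp
  have \<kappa>: "cut_function \<kappa>"
    unfolding cut_function_def
  proof (intro conjI allI ballI impI)
    fix s u v assume "u \<doteq> v"
    then have "inJ (u @ rev (altw e k)) \<longleftrightarrow> inJ (v @ rev (altw e k))" for k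
      using inJ_ceq ceq_app wr by blast
    then show "\<kappa> u s = \<kappa> v s" by (simp add: \<kappa>_def)
  next
    fix s u w assume "u \<in> J"
    then show "\<kappa> (u # w) s = \<kappa> w s" by (simp add: \<kappa>_def inJ_cons)
  qed
  have up: "pot \<kappa> (altw e a) = int a" for a
  proof (induction a)
    case (Suc a)
    have "inJ (altw e a @ rev (altw e a))"
      using ceq_rev_inv[OF wrd_altw] inJ_ceq inJ_Nil by blast
    moreover have "letter (e + Suc a) \<noteq> letter (e + a)" by (simp add: letter_neq)
    ultimately have 1: "\<kappa> (altw e a) (letter (e + Suc a)) = 1" unfolding \<kappa>_def by auto
    have 2: "\<kappa> (altw e (Suc a)) (letter (e + Suc a)) = 0"
    proof -
      have "letter (e + Suc a) = letter (e + k)" if "inJ (altw e (Suc a) @ rev (altw e k))" for k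
        unfolding altw_rev_inJ[OF that] ..
      then show ?thesis unfolding \<kappa>_def by (intro if_not_P) blast
    qed
    show ?case using Suc 1 2 letter_K by (simp add: altw_Suc)
  qed simp
  have bound: "pot \<kappa> w \<le> int (length w)" for w
  proof (induction w)
    case (Cons u w)
    have "\<kappa> w u - \<kappa> (u # w) u \<le> 1" by (simp add: \<kappa>_def)
    then show ?case using Cons by auto
  qed simp
  obtain v where v: "v \<doteq> altw e a" "length v = len (cls (altw e a))"
    using len_ex[OF wrd_altw] by blast
  have "a \<le> len (cls (altw e a))"
    using bound[of v] up[of a] pot_ceq[OF \<kappa> v(1)] v(2) by simp
  moreover have "len (cls (altw e a)) \<le> a"
    using len_le[OF wrd_altw cox_refl, of e a] by (simp add: altw_def)
  ultimately show ?thesis by simp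
qed

lemma len_alt: "len (cls (alt_word (letter a) (letter (Suc a)) k)) = k"
proof -
  have "alt_word (letter a) (letter (Suc a)) k = altw (a + k) k"
    by (auto simp: altw_def letter_def)
  then show ?thesis using len_altw by simp
qed

text \<open>The weights single out the edges at the coset \<open>W_J\<close> itself of type other
  than \<open>s\<close>. The result is the indicator function of the branches that leave
  \<open>W_J\<close> through \<open>K - {s}\<close>; it is 0 on \<open>W_J\<close> and beyond the
  edge of type \<open>s\<close>.\<close>

definition side :: "nat list \<Rightarrow> int" where
  "side = pot (\<lambda>w u. if inJ w \<and> u \<noteq> s then 1 else 0)"

lemma side_ceq: "u \<doteq> v \<Longrightarrow> side u = side v"
proof -
  have "cut_function (\<lambda>w u. if inJ w \<and> u \<noteq> s then 1 else 0)"
    unfolding cut_function_def using inJ_ceq inJ_cons by auto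
  then show "u \<doteq> v \<Longrightarrow> ?thesis" unfolding side_def by (rule pot_ceq)
qed

lemma side_change: "side (u # w) \<noteq> side w \<Longrightarrow> inJ w \<or> inJ (u # w)"
  unfolding side_def by (auto split: if_splits)

text \<open>For \<open>a > 0\<close> the rightmost letter of \<open>altw 1 a\<close> is
  \<open>s\<close>, while that of \<open>altw 0 (Suc a)\<close> is \<open>t\<close>. Only this
  letter leaves \<open>W_J\<close>, so only it can contribute.\<close>

lemma side_0: "side (altw 1 a) = 0"
proof (induction a)
  case (Suc a)
  then show ?case
    using altw_not_inJ[of a 1] altw_not_inJ[of "Suc a" 1]
    by (cases a) (auto simp: altw_Suc side_def)
qed (simp add: side_def)

lemma side_1: "side (altw 0 (Suc a)) = 1"
proof (induction a)
  case 0
  show ?case using st altw_not_inJ[of 1 0] by (simp add: altw_Suc side_def)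
next
  case (Suc a)
  then show ?case
    using altw_not_inJ[of "Suc a" 0] altw_not_inJ[of "Suc (Suc a)" 0]
    by (simp add: altw_Suc side_def)
qed

end

section \<open>Buildings and twin buildings\<close>

locale cox_building = coxeter +
  fixes C :: "'c set" and \<delta> :: "'c \<Rightarrow> 'c \<Rightarrow> nat list set"
  assumes bldg: "building n m C \<delta>"
begin

lemma dist_ex: "x \<in> C \<Longrightarrow> y \<in> C \<Longrightarrow> \<exists>w. wrd w \<and> \<delta> x y = cls w"
proof -
  have "\<forall>x\<in>C. \<forall>y\<in>C. \<delta> x y \<in> coxW n m" using bldg by (simp add: building_def)
  then show "x \<in> C \<Longrightarrow> y \<in> C \<Longrightarrow> ?thesis" unfolding coxW_iff by blast
qed

lemma dist_one: "x \<in> C \<Longrightarrow> y \<in> C \<Longrightarrow> \<delta> x y = cls [] \<longleftrightarrow> x = y"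
proof -
  have "\<forall>x\<in>C. \<forall>y\<in>C. \<delta> x y = cox_one n m \<longleftrightarrow> x = y" using bldg by (simp add: building_def)
  then show "x \<in> C \<Longrightarrow> y \<in> C \<Longrightarrow> ?thesis" unfolding cox_one_def by blast
qed

lemma dist_move:
  assumes "x \<in> C" "y \<in> C" "z \<in> C" "i < n" "\<delta> z x = cls [i]" "wrd w" "\<delta> x y = cls w"
  shows "\<delta> z y = cls (i # w) \<or> \<delta> z y = cls w"
    and "len (cls (i # w)) = len (cls w) + 1 \<Longrightarrow> \<delta> z y = cls (i # w)"
proof -
  have "(\<delta> z y = cox_mul n m (cox_gen n m i) (\<delta> x y) \<or> \<delta> z y = \<delta> x y) \<and>
        (cox_len n m (cox_mul n m (cox_gen n m i) (\<delta> x y)) = cox_len n m (\<delta> x y) + 1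
           \<longrightarrow> \<delta> z y = cox_mul n m (cox_gen n m i) (\<delta> x y))"
    using bldg[unfolded building_def, THEN conjunct2, THEN conjunct2, THEN conjunct2, THEN conjunct1]
      assms(1-5) unfolding cox_gen_def by blast
  then show "\<delta> z y = cls (i # w) \<or> \<delta> z y = cls w"
    "len (cls (i # w)) = len (cls w) + 1 \<Longrightarrow> \<delta> z y = cls (i # w)"
    using assms by (auto simp: gen_mul)
qed

lemma dist_ex_move:
  assumes "x \<in> C" "y \<in> C" "i < n" "wrd w" "\<delta> x y = cls w"
  shows "\<exists>z\<in>C. \<delta> z x = cls [i] \<and> \<delta> z y = cls (i # w)"
proof -
  have "\<exists>z\<in>C. \<delta> z x = cox_gen n m i \<and> \<delta> z y = cox_mul n m (cox_gen n m i) (\<delta> x y)"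
    using bldg[unfolded building_def, THEN conjunct2, THEN conjunct2, THEN conjunct2, THEN conjunct2]
      assms by blast
  then show ?thesis using assms gen_mul[of i w] by (simp add: cox_gen_def)
qed

lemma cls_gen_neq: "i < n \<Longrightarrow> cls [i] \<noteq> cls []"
  using one_neq_gen unfolding cox_gen_def cox_one_def by blast

lemma cls_cancel: "i < n \<Longrightarrow> wrd w \<Longrightarrow> cls (i # i # w) = cls w"
  using ceq_cancel2 cls_eq[of "i # i # w" w] by simp

lemma adj_sym:
  assumes "x \<in> C" "z \<in> C" "i < n" "\<delta> z x = cls [i]"
  shows "\<delta> x z = cls [i]"
proof -
  obtain w where w: "wrd w" "\<delta> x z = cls w" using dist_ex assms by blast
  have "cls [] = cls (i # w) \<or> cls [] = cls w"
    using dist_move(1)[of x z z i w] assms w dist_one[of z z] by simp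
  moreover have "cls w \<noteq> cls []"
    using dist_one[of x z] dist_one[of z x] assms w cls_gen_neq[of i] by auto
  ultimately have "i # w \<doteq> []" using cls_eq[of "[]" "i # w"] cox_sym by auto
  then have "i # i # w \<doteq> [i]" using ceq_cons assms by blast
  then show ?thesis using w cls_cancel[of i w] assms cls_eq[of "i # i # w" "[i]"] by simp
qed

lemma same_panel:
  assumes "x \<in> C" "z \<in> C" "z' \<in> C" "i < n" "\<delta> z x = cls [i]" "\<delta> z' x = cls [i]" "z \<noteq> z'"
  shows "\<delta> z z' = cls [i]"
  using dist_move(1)[of x z' z i "[i]"] adj_sym[of x z' i] cls_cancel[of i "[]"]
    dist_one[of z z'] assms by auto

text \<open>By the existence axiom any word for the Weyl distance, reduced or not, is the type of a
  gallery from \<open>x\<close> to \<open>y\<close>. Used with \<open>f\<close> a distance or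
  codistance to a fixed chamber.\<close>

lemma gallery:
  fixes f :: "'c \<Rightarrow> nat"
  assumes f: "\<And>x z i. x \<in> C \<Longrightarrow> z \<in> C \<Longrightarrow> i < n \<Longrightarrow> \<delta> z x = cls [i] \<Longrightarrow> f z \<le> f x + 1"
  shows "x \<in> C \<Longrightarrow> y \<in> C \<Longrightarrow> wrd w \<Longrightarrow> \<delta> x y = cls w \<Longrightarrow> f y \<le> f x + length w"
proof (induction w arbitrary: x)
  case Nil
  then show ?case using dist_one by auto
next
  case (Cons i w)
  obtain z where z: "z \<in> C" "\<delta> z x = cls [i]" "\<delta> z y = cls (i # i # w)"
    using dist_ex_move[of x y i "i # w"] Cons by auto
  have "f y \<le> f z + length w"
    using Cons z cls_cancel[of i w] by (intro Cons.IH) auto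
  then show ?case using f[of x z i] z Cons by simp
qed

lemma dist_lipschitz:
  assumes "E \<in> C" "x \<in> C" "z \<in> C" "i < n" "\<delta> z x = cls [i]"
  shows "len (\<delta> z E) \<le> len (\<delta> x E) + 1"
proof -
  obtain w where w: "wrd w" "\<delta> x E = cls w" using dist_ex assms by blast
  then show ?thesis
    using dist_move(1)[of x E z i w] assms len_cons_le[of i w] by auto
qed

lemma panel_alt:
  assumes "x \<in> C" "i < n"
  shows "panel n m C \<delta> i x = insert x {z \<in> C. \<delta> z x = cls [i]}"
proof -
  have "\<delta> x z = cls [i] \<longleftrightarrow> \<delta> z x = cls [i]" "\<delta> x z = cls [] \<longleftrightarrow> x = z" if "z \<in> C" for z
    using adj_sym[of x z i] adj_sym[of z x i] dist_one[of x z] assms that by blast+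
  then show ?thesis using assms unfolding panel_def cox_one_def cox_gen_def by blast
qed

end

locale cox_twin_side = cox_building n m C \<delta>
  for n m and C :: "'c set" and \<delta> +
  fixes D :: "'c set" and ds :: "'c \<Rightarrow> 'c \<Rightarrow> nat list set"
  assumes tside: "twin_side n m C \<delta> D ds"
    and codist_W: "\<And>x y. x \<in> C \<Longrightarrow> y \<in> D \<Longrightarrow> ds x y \<in> coxW n m"
begin

lemma codist_ex: "x \<in> C \<Longrightarrow> y \<in> D \<Longrightarrow> \<exists>w. wrd w \<and> ds x y = cls w"
  using codist_W[of x y] coxW_iff[of "ds x y"] by blast

lemma codist_move:
  assumes "x \<in> C" "y \<in> D" "z \<in> C" "i < n" "\<delta> z x = cls [i]" "wrd w" "ds x y = cls w"
    "len (cls (i # w)) + 1 = len (cls w)"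
  shows "ds z y = cls (i # w)"
proof -
  have "cox_len n m (cox_mul n m (cox_gen n m i) (ds x y)) + 1 = cox_len n m (ds x y)
      \<longrightarrow> ds z y = cox_mul n m (cox_gen n m i) (ds x y)"
    using tside assms(1-5) unfolding twin_side_def cox_gen_def by blast
  then show ?thesis using assms gen_mul[of i w] by simp
qed

lemma codist_ex_move:
  assumes "x \<in> C" "y \<in> D" "i < n" "wrd w" "ds x y = cls w"
  shows "\<exists>z\<in>C. \<delta> z x = cls [i] \<and> ds z y = cls (i # w)"
proof -
  have "\<exists>z\<in>C. \<delta> z x = cox_gen n m i \<and> ds z y = cox_mul n m (cox_gen n m i) (ds x y)"
    using tside assms unfolding twin_side_def by blast
  then show ?thesis using assms gen_mul[of i w] by (simp add: cox_gen_def)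
qed

text \<open>The twin axiom controls only steps that shorten the codistance. For a lengthening step
  take the chamber \<open>z'\<close> given by the existence axiom: either \<open>z = z'\<close>, or
  \<open>z\<close> is adjacent to \<open>z'\<close> and the step from \<open>z'\<close> to
  \<open>z\<close> shortens back to \<open>w\<close>.\<close>

lemma codist_move_cases:
  assumes "x \<in> C" "y \<in> D" "z \<in> C" "i < n" "\<delta> z x = cls [i]" "wrd w" "ds x y = cls w"
  shows "ds z y = cls (i # w) \<or> ds z y = cls w"
proof (cases "len (cls (i # w)) = len (cls w) + 1")
  case True
  obtain z' where z': "z' \<in> C" "\<delta> z' x = cls [i]" "ds z' y = cls (i # w)"
    using codist_ex_move assms by blast
  show ?thesis
  proof (cases "z = z'")
    case False
    have "\<delta> z z' = cls [i]" using same_panel[of x z z' i] assms z' False by blast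
    then have "ds z y = cls (i # i # w)"
      using codist_move[of z' y z i "i # w"] True assms z' cls_cancel[of i w] by simp
    then show ?thesis using cls_cancel assms by simp
  qed (use z' in simp)
next
  case False
  then show ?thesis using codist_move len_cons_cases[of i w] assms by blast
qed

lemma codist_lipschitz:
  assumes "x \<in> C" "y \<in> D" "z \<in> C" "i < n" "\<delta> z x = cls [i]"
  shows "len (ds z y) \<le> len (ds x y) + 1"
proof -
  obtain w where w: "wrd w" "ds x y = cls w" using codist_ex assms by blast
  then show ?thesis
    using codist_move_cases[of x y z i w] assms len_cons_le[of i w] by auto
qed

end

locale split_building = cox_building n m C \<delta> + split_pair n m J K s t
  for n m and C :: "'c set" and \<delta> J K s t
begin

text \<open>The types of the steps are \<open>s, t, s, t, ...\<close>. Minimality is not demanded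
  because alternating types force it, by \<open>len_altw\<close>.\<close>

definition ray :: "(nat \<Rightarrow> 'c) \<Rightarrow> bool" where
  "ray x \<longleftrightarrow> (\<forall>a. x a \<in> C \<and> \<delta> (x (Suc a)) (x a) = cls [letter a])"

lemma ray_C: "ray x \<Longrightarrow> x a \<in> C"
  by (simp add: ray_def)

lemma ex_ray:
  assumes thick: "\<And>x i. x \<in> C \<Longrightarrow> i < n \<Longrightarrow> \<exists>z\<in>C. \<delta> z x = cls [i]"
    and "p \<in> C" "z \<in> C" "\<delta> z p = cls [s]"
  shows "\<exists>x. ray x \<and> x 0 = p \<and> x (Suc 0) = z"
proof -
  define nxt where "nxt a y = (SOME z. z \<in> C \<and> \<delta> z y = cls [letter a])" for a y
  have nxt: "nxt a y \<in> C \<and> \<delta> (nxt a y) y = cls [letter a]" if "y \<in> C" for a y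
    unfolding nxt_def by (rule someI_ex) (use thick[OF that letter_lt] in blast)
  define x where "x a = (case a of 0 \<Rightarrow> p | Suc b \<Rightarrow> rec_nat z (\<lambda>k y. nxt (Suc k) y) b)" for a
  have C: "x a \<in> C" for a
  proof (cases a)
    case (Suc b)
    have "rec_nat z (\<lambda>k y. nxt (Suc k) y) b \<in> C"
      by (induction b) (use assms nxt in auto)
    then show ?thesis by (simp add: x_def Suc)
  qed (use assms in \<open>simp add: x_def\<close>)
  have "\<delta> (x (Suc a)) (x a) = cls [letter a]" for a
    using nxt[OF C[of a]] assms(4) by (cases a) (auto simp: x_def)
  then show ?thesis using C by (intro exI[of _ x]) (auto simp: ray_def x_def)
qed

text \<open>\<open>halftree E x\<close> tells on which side of the \<open>J\<close>-residue of \<open>E\<close> the chamber \<open>x\<close> lies.\<close>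

definition halftree :: "'c \<Rightarrow> 'c \<Rightarrow> int" where
  "halftree E x = side (SOME w. w \<in> \<delta> x E)"

lemma halftree_eq: "wrd w \<Longrightarrow> \<delta> x E = cls w \<Longrightarrow> halftree E x = side w"
  unfolding halftree_def using some_cls[of w] side_ceq by simp

text \<open>At the first step of a gallery of type \<open>w\<close> where the value changes,
  \<open>side_change\<close> puts one of the two Weyl distances to \<open>E\<close> into
  \<open>W_J\<close>, where lengths are bounded; the remaining gallery costs at most the rest of
  \<open>w\<close>. One \<open>M\<close> serves all \<open>E\<close>.\<close>

lemma halftree_change:
  "\<exists>M. \<forall>E\<in>C. \<forall>x\<in>C. \<forall>y\<in>C. \<forall>w. wrd w \<and> \<delta> x y = cls w \<and> halftree E x \<noteq> halftree E y
     \<longrightarrow> len (\<delta> y E) \<le> length w + M"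
proof -
  obtain M where M: "\<And>w. inJ w \<Longrightarrow> len (cls w) \<le> M" using J_len_bounded by blast
  have step: "len (\<delta> z E) \<le> M + 1"
    if *: "E \<in> C" "x \<in> C" "z \<in> C" "i < n" "\<delta> z x = cls [i]" "halftree E x \<noteq> halftree E z"
    for E x z i
  proof -
    obtain w where w: "wrd w" "\<delta> x E = cls w" using dist_ex * by blast
    have "\<delta> z E \<noteq> \<delta> x E" using *(6) unfolding halftree_def by metis
    then have z: "\<delta> z E = cls (i # w)" using dist_move(1)[of x E z i w] * w by auto
    have "side (i # w) \<noteq> side w"
      using *(6) halftree_eq[OF w] halftree_eq[of "i # w" z E] z w * by auto
    then have "inJ w \<or> inJ (i # w)" by (rule side_change)
    then show ?thesis using M[of w] M[of "i # w"] z len_cons_le[of i w] w * by auto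
  qed
  have "len (\<delta> y E) \<le> length w + (M + 1)"
    if "E \<in> C" "x \<in> C" "y \<in> C" "wrd w" "\<delta> x y = cls w" "halftree E x \<noteq> halftree E y" for E x y w
    using that
  proof (induction w arbitrary: x)
    case Nil
    then show ?case using dist_one by auto
  next
    case (Cons i w)
    obtain z where z: "z \<in> C" "\<delta> z x = cls [i]" "\<delta> z y = cls (i # i # w)"
      using dist_ex_move[of x y i "i # w"] Cons by auto
    then have zy: "\<delta> z y = cls w" using cls_cancel[of i w] Cons by simp
    show ?case
    proof (cases "halftree E x = halftree E z")
      case True
      then have "len (\<delta> y E) \<le> length w + (M + 1)" using Cons z zy by (intro Cons.IH) auto
      then show ?thesis by simp
    next
      case False
      then have "len (\<delta> z E) \<le> M + 1" using step[of E x z i] Cons z by auto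
      moreover have "len (\<delta> y E) \<le> len (\<delta> z E) + length w"
        using gallery[of "\<lambda>x. len (\<delta> x E)" z y w] dist_lipschitz Cons z zy by auto
      ultimately show ?thesis by simp
    qed
  qed
  then show ?thesis by blast
qed

lemma altw_len_Suc: "len (cls (altw e (Suc a))) = len (cls (altw e a)) + 1"
  by (simp add: len_altw)

text \<open>The base chamber is \<open>x 1\<close>, not \<open>x 0\<close>: from there a step of
  type \<open>s\<close> leads back to \<open>x 0\<close> and a step of type \<open>t\<close> on to
  \<open>x 2\<close>, so its residue separates the two.\<close>

lemma halftree_ray: assumes "ray x"
  shows "halftree (x (Suc 0)) (x a) = (if a \<ge> 2 then 1 else 0)"
proof -
  let ?E = "x (Suc 0)"
  have d: "\<delta> (x (Suc a)) ?E = cls (altw 0 a)" for a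
  proof (induction a)
    case 0
    then show ?case using assms dist_one by (simp add: ray_def)
  next
    case (Suc a)
    have "\<delta> (x (Suc (Suc a))) (x (Suc a)) = cls [letter (Suc a)]"
      using assms unfolding ray_def by blast
    then show ?case
      using dist_move(2)[OF _ _ _ letter_lt _ wrd_altw Suc, of "x (Suc (Suc a))" "Suc a"]
        altw_len_Suc[of 0 a] ray_C[OF assms] by (simp add: altw_Suc)
  qed
  have "\<delta> (x (Suc 0)) (x 0) = cls [letter 0]" using assms unfolding ray_def by blast
  then have "\<delta> (x 0) ?E = cls (altw 1 1)"
    using adj_sym[of "x 0" ?E s] ray_C[OF assms] letter_lt[of 0] by (simp add: altw_Suc)
  then have 0: "halftree ?E (x 0) = 0" using halftree_eq[OF wrd_altw] side_0 by simp
  show ?thesis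
  proof (cases a)
    case (Suc b)
    have "halftree ?E (x a) = side (altw 0 b)"
      using halftree_eq[OF wrd_altw d] Suc by simp
    then show ?thesis using side_1 by (cases b) (auto simp: Suc side_def)
  qed (use 0 in simp)
qed

text \<open>\<open>x 1\<close> and \<open>y 1\<close> lie in the \<open>s\<close>-panel of
  \<open>x 0\<close>, so \<open>y 1\<close> is itself \<open>s\<close>-adjacent to \<open>E\<close>,
  and all later Weyl distances from the ray to \<open>E\<close> still end with
  \<open>s\<close>.\<close>

lemma halftree_other_ray:
  assumes "ray x" "ray y" "x 0 = y 0" "x (Suc 0) \<noteq> y (Suc 0)"
  shows "halftree (x (Suc 0)) (y a) = 0"
proof -
  let ?E = "x (Suc 0)"
  have d: "\<delta> (y (Suc a)) ?E = cls (altw 1 (Suc a))" for a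
  proof (induction a)
    case 0
    have "\<delta> (y (Suc 0)) (y 0) = cls [letter 0]" "\<delta> (x (Suc 0)) (x 0) = cls [letter 0]"
      using assms(1,2) unfolding ray_def by blast+
    then have "\<delta> (y (Suc 0)) (x 0) = cls [s]" "\<delta> (x (Suc 0)) (x 0) = cls [s]"
      using assms(3) by auto
    then show ?case
      using same_panel[of "x 0" "y (Suc 0)" ?E s] ray_C assms letter_lt[of 0]
      by (simp add: altw_Suc)
  next
    case (Suc a)
    have "\<delta> (y (Suc (Suc a))) (y (Suc a)) = cls [letter (Suc a)]"
      using assms unfolding ray_def by blast
    then show ?case
      using dist_move(2)[OF _ _ _ letter_lt _ wrd_altw Suc, of "y (Suc (Suc a))" "Suc a"]
        altw_len_Suc[of 1 "Suc a"] ray_C assms by (simp add: altw_Suc)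
  qed
  show ?thesis
  proof (cases a)
    case 0
    then show ?thesis using halftree_ray[OF assms(1), of 0] assms(3) by simp
  next
    case (Suc b)
    then show ?thesis using halftree_eq[OF wrd_altw d] side_0 by simp
  qed
qed

end

locale split_twin = split_pair +
  fixes Cp Cm :: "'c set" and dp dm ds :: "'c \<Rightarrow> 'c \<Rightarrow> nat list set"
  assumes twin: "twin_building n m Cp Cm dp dm ds"
begin

lemma twin_parts:
  shows "Cp \<inter> Cm = {}" "building n m Cp dp" "building n m Cm dm"
    "\<forall>x\<in>Cp. \<forall>y\<in>Cm. ds x y \<in> coxW n m \<and> ds y x \<in> coxW n m"
    "\<forall>x\<in>Cp. \<forall>y\<in>Cm. ds x y = cox_inverse n m (ds y x) \<and> ds y x = cox_inverse n m (ds x y)"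
    "twin_side n m Cp dp Cm ds" "twin_side n m Cm dm Cp ds"
  by (insert twin[unfolded twin_building_def]) (elim conjE, assumption)+

sublocale plus: split_building n m Cp dp J K s t
  by unfold_locales (rule twin_parts)

sublocale minus: split_building n m Cm dm J K s t
  by unfold_locales (rule twin_parts)

sublocale plus: cox_twin_side n m Cp dp Cm ds
  by unfold_locales (use twin_parts(4,6) in blast)+

sublocale minus: cox_twin_side n m Cm dm Cp ds
  by unfold_locales (use twin_parts(4,7) in blast)+

lemma codist_swap:
  "x \<in> Cp \<Longrightarrow> y \<in> Cm \<Longrightarrow> wrd w \<Longrightarrow> ds x y = cls w \<longleftrightarrow> ds y x = cls (rev w)"
proof -
  assume xy: "x \<in> Cp" "y \<in> Cm" "wrd w"
  have "ds x y = cox_inverse n m (ds y x)" "ds y x = cox_inverse n m (ds x y)"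
    using twin_parts(5) xy by blast+
  then show ?thesis using inverse_cls[of w] inverse_cls[of "rev w"] xy by auto
qed

lemma len_codist_swap: "x \<in> Cp \<Longrightarrow> y \<in> Cm \<Longrightarrow> len (ds x y) = len (ds y x)"
proof -
  assume xy: "x \<in> Cp" "y \<in> Cm"
  obtain w where w: "wrd w" "ds x y = cls w" using plus.codist_ex xy by blast
  then have "ds y x = cls (rev w)" using codist_swap xy by blast
  then show ?thesis using w len_rev by simp
qed

lemma ex_codist:
  assumes "c \<in> Cp" "d \<in> Cm" "ds c d = cls []"
  shows "\<exists>p\<in>Cp. ds p d = cls (alt_word (letter a) (letter (Suc a)) k)"
proof (induction k arbitrary: a)
  case 0
  then show ?case using assms by auto
next
  case (Suc k)
  obtain p where "p \<in> Cp" "ds p d = cls (alt_word (letter (Suc a)) (letter a) k)"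
    using Suc[of "Suc a"] by auto
  then show ?case
    using plus.codist_ex_move[OF _ assms(2) letter_lt wrd_alt, of p "Suc a" a k a] by auto
qed

text \<open>Each step along \<open>x\<close> removes the first letter of the codistance word, each
  step along \<open>y\<close>, after swapping the arguments, the last one. As \<open>L\<close> is
  odd the word starts and ends with \<open>s\<close>, so both rays begin with the right type. At
  \<open>a + b = L\<close> the chambers are opposite.\<close>

lemma codist_rays:
  assumes x: "plus.ray x" and y: "minus.ray y" and L: "odd L"
    and xy: "ds (x 0) (y 0) = cls (alt_word s t L)"
  shows "a + b \<le> L \<Longrightarrow>
    ds (x a) (y b) = cls (alt_word (letter a) (letter (Suc a)) (L - (a + b)))"
proof -
  have drop1: "len (cls (letter a # alt_word (letter a) (letter (Suc a)) (Suc k))) + 1 =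
      len (cls (alt_word (letter a) (letter (Suc a)) (Suc k)))"
    "cls (letter a # alt_word (letter a) (letter (Suc a)) (Suc k)) =
      cls (alt_word (letter (Suc a)) (letter (Suc (Suc a))) k)" for a k
    using plus.cls_cancel[OF letter_lt wrd_alt, of a "Suc a" a k]
      len_alt[of a "Suc k"] len_alt[of "Suc a" k] by auto
  have base: "a \<le> L \<Longrightarrow> ds (x a) (y 0) = cls (alt_word (letter a) (letter (Suc a)) (L - a))" for a
  proof (induction a)
    case 0
    then show ?case using xy by simp
  next
    case (Suc a)
    have "L - a = Suc (L - Suc a)" using Suc by simp
    then have IH: "ds (x a) (y 0) = cls (alt_word (letter a) (letter (Suc a)) (Suc (L - Suc a)))"
      using Suc by simp
    have "dp (x (Suc a)) (x a) = cls [letter a]" using x unfolding plus.ray_def by blast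
    then have "ds (x (Suc a)) (y 0)
        = cls (letter a # alt_word (letter a) (letter (Suc a)) (Suc (L - Suc a)))"
      by (rule plus.codist_move[OF plus.ray_C[OF x] minus.ray_C[OF y] plus.ray_C[OF x]
            letter_lt _ wrd_alt IH drop1(1)])
    then show ?case unfolding drop1(2) .
  qed
  \<comment> \<open>For \<open>a + b\<close> even the length is odd and the word is a palindrome;
    for \<open>a + b\<close> odd reversal exchanges the letters, and
    \<open>letter b = letter (Suc a)\<close>.\<close>
  have rv: "rev (alt_word (letter a) (letter (Suc a)) (L - (a + b)))
      = alt_word (letter b) (letter (Suc b)) (L - (a + b))" if "a + b \<le> L" for a b
    using L that by (auto simp: rev_alt_word letter_def)
  have swap: "ds (x a) (y b) = cls (alt_word (letter a) (letter (Suc a)) (L - (a + b)))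
      \<longleftrightarrow> ds (y b) (x a) = cls (alt_word (letter b) (letter (Suc b)) (L - (a + b)))"
    if "a + b \<le> L" for a b
    using codist_swap[OF plus.ray_C[OF x] minus.ray_C[OF y] wrd_alt] rv[OF that] by metis
  show "a + b \<le> L \<Longrightarrow> ?thesis"
  proof (induction b)
    case 0
    then show ?case using base by simp
  next
    case (Suc b)
    have e: "L - (a + b) = Suc (L - (a + Suc b))" using Suc by simp
    have "ds (y b) (x a) = cls (alt_word (letter b) (letter (Suc b)) (L - (a + b)))"
      using Suc swap[of a b] by simp
    then have IH: "ds (y b) (x a) = cls (alt_word (letter b) (letter (Suc b)) (Suc (L - (a + Suc b))))"
      using e by metis
    have "dm (y (Suc b)) (y b) = cls [letter b]" using y unfolding minus.ray_def by blast
    then have "ds (y (Suc b)) (x a)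
        = cls (letter b # alt_word (letter b) (letter (Suc b)) (Suc (L - (a + Suc b))))"
      by (rule minus.codist_move[OF minus.ray_C[OF y] plus.ray_C[OF x] minus.ray_C[OF y]
            letter_lt _ wrd_alt IH drop1(1)])
    then have "ds (y (Suc b)) (x a) =
        cls (alt_word (letter (Suc b)) (letter (Suc (Suc b))) (L - (a + Suc b)))"
      unfolding drop1(2) .
    then show ?case using swap[of a "Suc b"] Suc by simp
  qed
qed

end

section \<open>Loops in Cayley graphs of groups with finiteness conditions\<close>

text \<open>A homological substitute for finite presentability: loops with steps in \<open>A\<close> bound in the
  Rips complex with steps in \<open>F\<close>, as tested by integral cochains.\<close>

definition loops_fill :: "('g, 'b) monoid_scheme \<Rightarrow> bool" where
  "loops_fill G \<longleftrightarrow> (\<forall>A. finite A \<and> A \<subseteq> carrier G \<longrightarrow> (\<exists>F. finite F \<and> F \<subseteq> carrier G \<and>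
     (\<forall>\<omega> :: 'g \<Rightarrow> 'g \<Rightarrow> int.
       (\<forall>a\<in>carrier G. \<forall>b\<in>carrier G. \<forall>c\<in>carrier G.
          inv\<^bsub>G\<^esub> a \<otimes>\<^bsub>G\<^esub> b \<in> F \<and> inv\<^bsub>G\<^esub> b \<otimes>\<^bsub>G\<^esub> c \<in> F \<longrightarrow> \<omega> a b + \<omega> b c = \<omega> a c) \<longrightarrow>
       (\<forall>\<gamma> N. (\<forall>i\<le>N. \<gamma> i \<in> carrier G) \<and> \<gamma> N = \<gamma> 0 \<and>
          (\<forall>i<N. inv\<^bsub>G\<^esub> (\<gamma> i) \<otimes>\<^bsub>G\<^esub> \<gamma> (Suc i) \<in> A) \<longrightarrow>
          (\<Sum>i<N. \<omega> (\<gamma> i) (\<gamma> (Suc i))) = 0))))"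

context group
begin

subsection \<open>Finitely presented groups\<close>

definition letter_val :: "'a \<times> bool \<Rightarrow> 'a" where
  "letter_val p = (if snd p then fst p else inv (fst p))"

lemma eval_word_Nil [simp]: "eval_word G [] = \<one>"
  by (simp add: eval_word_def)

lemma eval_word_Cons [simp]: "eval_word G (p # w) = letter_val p \<otimes> eval_word G w"
  by (simp add: eval_word_def letter_val_def split: prod.split)

fun word_sum :: "('a \<Rightarrow> 'a \<Rightarrow> int) \<Rightarrow> 'a \<Rightarrow> ('a \<times> bool) list \<Rightarrow> int" where
  "word_sum \<omega> g [] = 0"
| "word_sum \<omega> g (p # w) = \<omega> g (g \<otimes> letter_val p) + word_sum \<omega> (g \<otimes> letter_val p) w"

context
  fixes B :: "'a set"
  assumes B: "B \<subseteq> carrier G"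
begin

lemma letter_val_closed: "p \<in> B \<times> UNIV \<Longrightarrow> letter_val p \<in> carrier G"
  using B by (auto simp: letter_val_def)

lemma eval_word_closed: "set w \<subseteq> B \<times> UNIV \<Longrightarrow> eval_word G w \<in> carrier G"
  by (induction w) (auto simp: letter_val_closed)

lemma eval_word_append:
  "set u \<subseteq> B \<times> UNIV \<Longrightarrow> set v \<subseteq> B \<times> UNIV \<Longrightarrow>
    eval_word G (u @ v) = eval_word G u \<otimes> eval_word G v"
  by (induction u) (auto simp: eval_word_closed letter_val_closed m_assoc)

lemma word_sum_append:
  "set u \<subseteq> B \<times> UNIV \<Longrightarrow> set v \<subseteq> B \<times> UNIV \<Longrightarrow> g \<in> carrier G \<Longrightarrow>
    word_sum \<omega> g (u @ v) = word_sum \<omega> g u + word_sum \<omega> (g \<otimes> eval_word G u) v"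
  by (induction u arbitrary: g) (auto simp: eval_word_closed letter_val_closed m_assoc)

lemma ex_word:
  assumes "g \<in> generate G B"
  shows "\<exists>w. set w \<subseteq> B \<times> UNIV \<and> eval_word G w = g"
  using assms
proof (induction rule: generate.induct)
  case one
  show ?case by (intro exI[of _ "[]"]) auto
next
  case (incl h)
  then show ?case using B by (intro exI[of _ "[(h, True)]"]) (auto simp: letter_val_def)
next
  case (inv h)
  then show ?case using B by (intro exI[of _ "[(h, False)]"]) (auto simp: letter_val_def)
next
  case (eng g h)
  then obtain u v where "set u \<subseteq> B \<times> UNIV" "eval_word G u = g"
    "set v \<subseteq> B \<times> UNIV" "eval_word G v = h" by auto
  then show ?case by (intro exI[of _ "u @ v"]) (auto simp: eval_word_append)
qed

text \<open>An inserted relator or inverse pair ends where it starts and sums to 0. The rules of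
  \<open>pres_eq\<close> allow arbitrary context words, so the restriction to letters from
  \<open>B\<close> is carried through the induction as an equivalence.\<close>

lemma pres_eq_word_sum:
  assumes R: "\<And>r. r \<in> R \<Longrightarrow> set r \<subseteq> B \<times> UNIV \<and> eval_word G r = \<one>"
    and \<omega>_rel: "\<And>r g. r \<in> R \<Longrightarrow> g \<in> carrier G \<Longrightarrow> word_sum \<omega> g r = 0"
    and \<omega>_inv: "\<And>g p. g \<in> carrier G \<Longrightarrow> p \<in> B \<times> UNIV \<Longrightarrow>
      \<omega> g (g \<otimes> letter_val p) + \<omega> (g \<otimes> letter_val p) g = 0"
  shows "pres_eq B R u v \<Longrightarrow> (set u \<subseteq> B \<times> UNIV \<longleftrightarrow> set v \<subseteq> B \<times> UNIV) \<and>
    (set u \<subseteq> B \<times> UNIV \<longrightarrow> eval_word G u = eval_word G v \<and>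
      (\<forall>g\<in>carrier G. word_sum \<omega> g u = word_sum \<omega> g v))"
proof (induction rule: pres_eq.induct)
  case (pres_free x u b v)
  let ?m = "[(x, b), (x, \<not> b)]"
  have m: "set ?m \<subseteq> B \<times> UNIV" using pres_free by simp
  have x: "x \<in> carrier G" using B pres_free by auto
  have e: "eval_word G ?m = \<one>" using x by (cases b) (auto simp: letter_val_def)
  have s: "word_sum \<omega> g ?m = 0" if "g \<in> carrier G" for g
    using \<omega>_inv[OF that, of "(x, b)"] pres_free x that
    by (cases b) (auto simp: letter_val_def m_assoc)
  show ?case
  proof (intro conjI impI ballI)
    show iff: "set (u @ ?m @ v) \<subseteq> B \<times> UNIV \<longleftrightarrow> set (u @ v) \<subseteq> B \<times> UNIV" using m by auto
    assume "set (u @ ?m @ v) \<subseteq> B \<times> UNIV"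
    then have uv: "set u \<subseteq> B \<times> UNIV" "set v \<subseteq> B \<times> UNIV" "set (?m @ v) \<subseteq> B \<times> UNIV" by auto
    have c: "eval_word G u \<in> carrier G" "eval_word G v \<in> carrier G" using uv eval_word_closed by auto
    show "eval_word G (u @ ?m @ v) = eval_word G (u @ v)"
      using eval_word_append[OF uv(1,3)] eval_word_append[OF m uv(2)] eval_word_append[OF uv(1,2)] e c
      by simp
    fix g assume g: "g \<in> carrier G"
    show "word_sum \<omega> g (u @ ?m @ v) = word_sum \<omega> g (u @ v)"
      unfolding word_sum_append[OF uv(1,3) g] word_sum_append[OF uv(1,2) g]
        word_sum_append[OF m uv(2) m_closed[OF g c(1)]]
      using s[OF m_closed[OF g c(1)]] e g c by simp
  qed
next
  case (pres_rel r u v)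
  note m = R[OF pres_rel, THEN conjunct1] and e = R[OF pres_rel, THEN conjunct2]
  show ?case
  proof (intro conjI impI ballI)
    show iff: "set (u @ r @ v) \<subseteq> B \<times> UNIV \<longleftrightarrow> set (u @ v) \<subseteq> B \<times> UNIV" using m by auto
    assume "set (u @ r @ v) \<subseteq> B \<times> UNIV"
    then have uv: "set u \<subseteq> B \<times> UNIV" "set v \<subseteq> B \<times> UNIV" "set (r @ v) \<subseteq> B \<times> UNIV" by auto
    have c: "eval_word G u \<in> carrier G" "eval_word G v \<in> carrier G" using uv eval_word_closed by auto
    show "eval_word G (u @ r @ v) = eval_word G (u @ v)"
      using eval_word_append[OF uv(1,3)] eval_word_append[OF m uv(2)] eval_word_append[OF uv(1,2)] e c
      by simp
    fix g assume g: "g \<in> carrier G"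
    show "word_sum \<omega> g (u @ r @ v) = word_sum \<omega> g (u @ v)"
      unfolding word_sum_append[OF uv(1,3) g] word_sum_append[OF uv(1,2) g]
        word_sum_append[OF m uv(2) m_closed[OF g c(1)]]
      using \<omega>_rel[OF pres_rel m_closed[OF g c(1)]] e g c by simp
  qed
next
  case (pres_sym u v)
  show ?case using pres_sym.IH by metis
next
  case (pres_trans u v w)
  show ?case
  proof (intro conjI impI ballI)
    show "set u \<subseteq> B \<times> UNIV \<longleftrightarrow> set w \<subseteq> B \<times> UNIV"
      by (rule trans[OF pres_trans.IH(1)[THEN conjunct1] pres_trans.IH(2)[THEN conjunct1]])
    assume u: "set u \<subseteq> B \<times> UNIV"
    note v = pres_trans.IH(1)[THEN conjunct1, THEN iffD1, OF u]
    note 1 = pres_trans.IH(1)[THEN conjunct2, THEN mp, OF u]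
    note 2 = pres_trans.IH(2)[THEN conjunct2, THEN mp, OF v]
    show "eval_word G u = eval_word G w" by (rule trans[OF 1[THEN conjunct1] 2[THEN conjunct1]])
    fix g assume g: "g \<in> carrier G"
    show "word_sum \<omega> g u = word_sum \<omega> g w"
      by (rule trans[OF 1[THEN conjunct2, THEN bspec, OF g] 2[THEN conjunct2, THEN bspec, OF g]])
  qed
next
  case (pres_refl w)
  show ?case by (intro conjI impI ballI refl)
qed

end

lemma step_mult: "a \<in> carrier G \<Longrightarrow> b \<in> carrier G \<Longrightarrow> inv a \<otimes> (a \<otimes> b) = b"
  by (simp add: m_assoc[symmetric])

lemma step_mult': "a \<in> carrier G \<Longrightarrow> b \<in> carrier G \<Longrightarrow> a \<otimes> (inv a \<otimes> b) = b"
  by (simp add: m_assoc[symmetric])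

text \<open>\<open>F\<close> is a ball whose radius bounds the relators and the words for
  \<open>A\<close>. On it \<open>\<omega>\<close> is additive, so a relator sums to
  \<open>\<omega> g g = 0\<close>; a loop with steps in \<open>A\<close> spells a word for the
  identity, which the presentation reduces to the empty word.\<close>

lemma finitely_presented_loops_fill:
  assumes "finitely_presented G"
  shows "loops_fill G"
  unfolding loops_fill_def
proof (intro allI impI)
  fix A assume A: "finite A \<and> A \<subseteq> carrier G"
  obtain B R where BR: "finite B \<and> B \<subseteq> carrier G \<and> generate G B = carrier G \<and> finite R \<and>
        (\<forall>r\<in>R. set r \<subseteq> B \<times> UNIV \<and> eval_word G r = \<one>) \<and>
        (\<forall>w. set w \<subseteq> B \<times> UNIV \<and> eval_word G w = \<one> \<longrightarrow> pres_eq B R w [])"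
    using assms unfolding finitely_presented_def by (elim exE)
  have B: "finite B" "B \<subseteq> carrier G" and gen: "generate G B = carrier G" and R1: "finite R"
    and R2: "\<forall>r\<in>R. set r \<subseteq> B \<times> UNIV \<and> eval_word G r = \<one>"
    and pres: "\<forall>w. set w \<subseteq> B \<times> UNIV \<and> eval_word G w = \<one> \<longrightarrow> pres_eq B R w []"
    by (insert BR) (elim conjE, assumption)+
  note R = R1 R2[rule_format]
  have "\<forall>g. \<exists>w. g \<in> carrier G \<longrightarrow> set w \<subseteq> B \<times> UNIV \<and> eval_word G w = g"
    using ex_word[OF B(2)] gen by blast
  from choice[OF this] obtain wd
    where wd: "\<And>g. g \<in> carrier G \<Longrightarrow> set (wd g) \<subseteq> B \<times> UNIV \<and> eval_word G (wd g) = g"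
    by blast
  \<comment> \<open>The extra 1 puts single letters and their inverses into
    \<open>F\<close>.\<close>
  define Ls where "Ls = length ` (R \<union> wd ` A) \<union> {1}"
  have fL: "finite Ls" using A R by (simp add: Ls_def)
  define N where "N = Max Ls"
  have LN: "\<And>k. k \<in> Ls \<Longrightarrow> k \<le> N" using fL by (simp add: N_def)
  define F where "F = eval_word G ` {w. set w \<subseteq> B \<times> UNIV \<and> length w \<le> N}"
  have F1: "finite F" unfolding F_def
    using B finite_lists_length_le[of "B \<times> (UNIV :: bool set)" N] by simp
  have F2: "F \<subseteq> carrier G" unfolding F_def using eval_word_closed[OF B(2)] by auto
  have key: "(\<Sum>i<M. \<omega> (\<gamma> i) (\<gamma> (Suc i))) = 0"
    if \<omega>: "\<forall>a\<in>carrier G. \<forall>b\<in>carrier G. \<forall>c\<in>carrier G.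
          inv a \<otimes> b \<in> F \<and> inv b \<otimes> c \<in> F \<longrightarrow> \<omega> a b + \<omega> b c = \<omega> a c"
      and \<gamma>: "(\<forall>i\<le>M. \<gamma> i \<in> carrier G) \<and> \<gamma> M = \<gamma> 0 \<and> (\<forall>i<M. inv (\<gamma> i) \<otimes> \<gamma> (Suc i) \<in> A)"
    for \<omega> :: "'a \<Rightarrow> 'a \<Rightarrow> int" and \<gamma> M
  proof -
    have inF: "eval_word G w \<in> F" if "set w \<subseteq> B \<times> UNIV" "length w \<le> N" for w
      using that unfolding F_def by blast
    have N1: "1 \<le> N" using LN[of 1] by (simp add: Ls_def)
    have oneF: "\<one> \<in> F" using inF[of "[]"] by simp
    have letF: "letter_val p \<in> F" if "p \<in> B \<times> UNIV" for p
      using inF[of "[p]"] that N1 letter_val_closed[OF B(2) that] by simp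
    have refl: "\<omega> g g = 0" if "g \<in> carrier G" for g
      using \<omega>[rule_format, of g g g] that oneF by simp
    have tri: "\<omega> g (g \<otimes> x) + \<omega> (g \<otimes> x) (g \<otimes> x \<otimes> y) = \<omega> g (g \<otimes> x \<otimes> y)"
      if "g \<in> carrier G" "x \<in> carrier G" "y \<in> carrier G" "x \<in> F" "y \<in> F" for g x y
      using \<omega>[rule_format, of g "g \<otimes> x" "g \<otimes> x \<otimes> y"] that
        step_mult[of g x] step_mult[of "g \<otimes> x" y] by simp
    \<comment> \<open>Additivity is applied to the first letter and the remaining suffix, whose
      values both lie in \<open>F\<close>.\<close>
    have short: "word_sum \<omega> g w = \<omega> g (g \<otimes> eval_word G w)"
      if "set w \<subseteq> B \<times> UNIV" "length w \<le> N" "g \<in> carrier G" for w g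
      using that
    proof (induction w arbitrary: g)
      case Nil
      then show ?case using refl by simp
    next
      case (Cons p w)
      have c: "letter_val p \<in> carrier G" "eval_word G w \<in> carrier G"
        using Cons letter_val_closed[OF B(2)] eval_word_closed[OF B(2)] by auto
      have "word_sum \<omega> (g \<otimes> letter_val p) w
          = \<omega> (g \<otimes> letter_val p) (g \<otimes> letter_val p \<otimes> eval_word G w)"
        using Cons c by (intro Cons.IH) auto
      moreover have "\<omega> g (g \<otimes> letter_val p) + \<omega> (g \<otimes> letter_val p) (g \<otimes> letter_val p \<otimes> eval_word G w)
          = \<omega> g (g \<otimes> letter_val p \<otimes> eval_word G w)"
        using Cons c letF[of p] inF[of w] by (intro tri) auto
      ultimately show ?case using Cons c by (simp add: m_assoc)
    qed
    have rel: "word_sum \<omega> g r = 0" if "r \<in> R" "g \<in> carrier G" for r g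
      using short[of r g] R(2)[OF that(1)] LN[of "length r"] that refl by (simp add: Ls_def)
    have inv0: "\<omega> g (g \<otimes> letter_val p) + \<omega> (g \<otimes> letter_val p) g = 0"
      if "g \<in> carrier G" "p \<in> B \<times> UNIV" for g p
    proof -
      let ?x = "letter_val p"
      have x: "?x \<in> carrier G" using letter_val_closed[OF B(2) that(2)] .
      have "letter_val (fst p, \<not> snd p) = inv ?x" using that B by (auto simp: letter_val_def)
      then have "inv ?x \<in> F" using letF[of "(fst p, \<not> snd p)"] that by auto
      then show ?thesis
        using tri[of g ?x "inv ?x"] that x letF[OF that(2)] refl by (simp add: m_assoc)
    qed
    let ?w = "\<lambda>i. wd (inv (\<gamma> i) \<otimes> \<gamma> (Suc i))"
    define W where "W k = concat (map ?w [0..<k])" for k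
    have step: "set (?w i) \<subseteq> B \<times> UNIV" "eval_word G (?w i) = inv (\<gamma> i) \<otimes> \<gamma> (Suc i)"
        "length (?w i) \<le> N" if "i < M" for i
      using wd[of "inv (\<gamma> i) \<otimes> \<gamma> (Suc i)"] that \<gamma> LN[of "length (?w i)"] by (auto simp: Ls_def)
    have main: "set (W k) \<subseteq> B \<times> UNIV \<and> \<gamma> 0 \<otimes> eval_word G (W k) = \<gamma> k \<and>
        word_sum \<omega> (\<gamma> 0) (W k) = (\<Sum>i<k. \<omega> (\<gamma> i) (\<gamma> (Suc i)))" if "k \<le> M" for k
      using that
    proof (induction k)
      case 0
      then show ?case using \<gamma> by (simp add: W_def)
    next
      case (Suc k)
      then have IH: "set (W k) \<subseteq> B \<times> UNIV" "\<gamma> 0 \<otimes> eval_word G (W k) = \<gamma> k"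
        "word_sum \<omega> (\<gamma> 0) (W k) = (\<Sum>i<k. \<omega> (\<gamma> i) (\<gamma> (Suc i)))" by auto
      have k: "k < M" using Suc by simp
      have c: "\<gamma> 0 \<in> carrier G" "\<gamma> k \<in> carrier G" "\<gamma> (Suc k) \<in> carrier G" using \<gamma> k by auto
      have W: "W (Suc k) = W k @ ?w k" by (simp add: W_def)
      have Wc: "eval_word G (W k) \<in> carrier G" using eval_word_closed[OF B(2) IH(1)] .
      have e: "\<gamma> k \<otimes> eval_word G (?w k) = \<gamma> (Suc k)"
        using step(2)[OF k] c step_mult' by simp
      have "\<gamma> 0 \<otimes> eval_word G (W (Suc k)) = \<gamma> 0 \<otimes> eval_word G (W k) \<otimes> eval_word G (?w k)"
        unfolding W eval_word_append[OF B(2) IH(1) step(1)[OF k]]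
        using c Wc eval_word_closed[OF B(2) step(1)[OF k]] by (simp add: m_assoc)
      moreover have "word_sum \<omega> (\<gamma> 0) (W (Suc k)) = word_sum \<omega> (\<gamma> 0) (W k) + word_sum \<omega> (\<gamma> k) (?w k)"
        unfolding W word_sum_append[OF B(2) IH(1) step(1)[OF k] c(1)] IH(2) ..
      moreover have "word_sum \<omega> (\<gamma> k) (?w k) = \<omega> (\<gamma> k) (\<gamma> (Suc k))"
        using short[OF step(1)[OF k] step(3)[OF k] c(2)] e by simp
      moreover have "set (W (Suc k)) \<subseteq> B \<times> UNIV" using W IH(1) step(1)[OF k] by simp
      ultimately show ?case using IH e by simp
    qed
    have "eval_word G (W M) = \<one>"
    proof -
      have "\<gamma> 0 \<otimes> eval_word G (W M) = \<gamma> 0" using main[of M] \<gamma> by simp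
      then show ?thesis
        using eval_word_closed[OF B(2), of "W M"] main[of M] \<gamma> l_cancel_one[of "\<gamma> 0"] by auto
    qed
    then have "pres_eq B R (W M) []" using pres main[OF order_refl] by blast
    then have "word_sum \<omega> (\<gamma> 0) (W M) = word_sum \<omega> (\<gamma> 0) []"
      using pres_eq_word_sum[OF B(2) R(2) rel inv0] main[of M] \<gamma> by blast
    then show ?thesis using main[of M] by simp
  qed
  show "\<exists>F. finite F \<and> F \<subseteq> carrier G \<and>
     (\<forall>\<omega> :: 'a \<Rightarrow> 'a \<Rightarrow> int.
       (\<forall>a\<in>carrier G. \<forall>b\<in>carrier G. \<forall>c\<in>carrier G.
          inv a \<otimes> b \<in> F \<and> inv b \<otimes> c \<in> F \<longrightarrow> \<omega> a b + \<omega> b c = \<omega> a c) \<longrightarrow>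
       (\<forall>\<gamma> N. (\<forall>i\<le>N. \<gamma> i \<in> carrier G) \<and> \<gamma> N = \<gamma> 0 \<and>
          (\<forall>i<N. inv (\<gamma> i) \<otimes> \<gamma> (Suc i) \<in> A) \<longrightarrow>
          (\<Sum>i<N. \<omega> (\<gamma> i) (\<gamma> (Suc i))) = 0))"
    by (intro exI[of _ F] conjI allI impI F1 F2) (rule key, assumption+)
qed

end

subsection \<open>Groups of type FP2\<close>

text \<open>The augmented bar complex in homogeneous form: the list \<open>[g\<^sub>0, \<dots>, g\<^sub>k]\<close> is a
  \<open>k\<close>-simplex, so that the degree is the length minus one.\<close>

abbreviation map_chain :: "('x \<Rightarrow> 'y) \<Rightarrow> ('x \<Rightarrow>\<^sub>0 int) \<Rightarrow> ('y \<Rightarrow>\<^sub>0 int)" where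
  "map_chain f \<equiv> frag_extend (\<lambda>x. frag_of (f x))"

text \<open>With \<open>a # l\<close> read as the cone over \<open>l\<close> with apex
  \<open>a\<close>, this is the cone formula; unfolded it is the alternating sum of the faces. On a
  vertex it is the augmentation, with value \<open>frag_of []\<close>.\<close>

primrec simplex_bd :: "'x list \<Rightarrow> ('x list \<Rightarrow>\<^sub>0 int)" where
  "simplex_bd [] = 0"
| "simplex_bd (a # l) = frag_of l - map_chain ((#) a) (simplex_bd l)"

abbreviation bd :: "('x list \<Rightarrow>\<^sub>0 int) \<Rightarrow> ('x list \<Rightarrow>\<^sub>0 int)" where
  "bd \<equiv> frag_extend simplex_bd"

lemma frag_induct [case_names zero one diff]:
  fixes c :: "'x \<Rightarrow>\<^sub>0 int"
  assumes "P 0" "\<And>x. P (frag_of x)" "\<And>a b. P a \<Longrightarrow> P b \<Longrightarrow> P (a - b)"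
  shows "P c"
  using assms by (intro frag_induction[of c UNIV P]) auto

lemma frag_extend_map_chain: "frag_extend f (map_chain g c) = frag_extend (\<lambda>x. f (g x)) c"
  using frag_extend_compose[of f g c] by (simp add: o_def)

lemma frag_extend_frag_extend:
  "frag_extend f (frag_extend h c) = frag_extend (\<lambda>x. frag_extend f (h x)) c"
  by (induction c rule: frag_induct) (simp_all add: frag_extend_diff)

text \<open>Coning is a contracting homotopy of the augmented complex: every cycle is filled by its
  cone.\<close>

lemma bd_cone: "bd (map_chain ((#) a) c) = c - map_chain ((#) a) (bd c)"
  by (induction c rule: frag_induct) (simp_all add: frag_extend_diff o_def)

lemma bd_map: "bd (map_chain (map f) c) = map_chain (map f) (bd c)"
proof (induction c rule: frag_induct)
  case (one l)
  have "simplex_bd (map f l) = map_chain (map f) (simplex_bd l)"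
  proof (induction l)
    case (Cons a l)
    then show ?case by (simp add: frag_extend_diff frag_extend_map_chain)
  qed simp
  then show ?case by simp
qed (simp_all add: frag_extend_diff)

context group
begin

abbreviation trans_chain :: "'a \<Rightarrow> ('a list \<Rightarrow>\<^sub>0 int) \<Rightarrow> ('a list \<Rightarrow>\<^sub>0 int)" where
  "trans_chain g \<equiv> map_chain (map ((\<otimes>) g))"

definition simplices :: "nat \<Rightarrow> 'a list set" where
  "simplices k = {l. length l = k \<and> set l \<subseteq> carrier G}"

definition chains :: "nat \<Rightarrow> ('a list \<Rightarrow>\<^sub>0 int) set" where
  "chains k = {c. Poly_Mapping.keys c \<subseteq> simplices k}"

lemma chains_0 [simp]: "0 \<in> chains k"
  and chains_add: "c \<in> chains k \<Longrightarrow> d \<in> chains k \<Longrightarrow> c + d \<in> chains k"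
  and chains_diff: "c \<in> chains k \<Longrightarrow> d \<in> chains k \<Longrightarrow> c - d \<in> chains k"
  and chains_cmul: "c \<in> chains k \<Longrightarrow> frag_cmul z c \<in> chains k"
  and chains_of: "frag_of l \<in> chains k \<longleftrightarrow> l \<in> simplices k"
  unfolding chains_def using keys_add[of c d] keys_diff[of c d] keys_cmul[of z c] by auto

lemma chains_extend:
  "(\<And>x. x \<in> Poly_Mapping.keys c \<Longrightarrow> f x \<in> chains k) \<Longrightarrow> frag_extend f c \<in> chains k"
  unfolding chains_def using keys_frag_extend[of f c] by blast

lemma chains_cone: "c \<in> chains k \<Longrightarrow> a \<in> carrier G \<Longrightarrow> map_chain ((#) a) c \<in> chains (Suc k)"
  by (rule chains_extend) (auto simp: chains_def simplices_def)

lemma chains_trans: "c \<in> chains k \<Longrightarrow> g \<in> carrier G \<Longrightarrow> trans_chain g c \<in> chains k"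
  by (rule chains_extend) (auto simp: chains_def simplices_def)

lemma trans_trans:
  assumes "c \<in> chains k" "g \<in> carrier G" "h \<in> carrier G"
  shows "trans_chain g (trans_chain h c) = trans_chain (g \<otimes> h) c"
proof -
  have *: "map ((\<otimes>) g) (map ((\<otimes>) h) l) = map ((\<otimes>) (g \<otimes> h)) l" if "l \<in> Poly_Mapping.keys c" for l
  proof -
    have "set l \<subseteq> carrier G" using that assms(1) by (auto simp: chains_def simplices_def)
    then show ?thesis using assms by (induction l) (auto simp: m_assoc)
  qed
  show ?thesis unfolding frag_extend_map_chain by (rule frag_extend_eq) (simp only: *)
qed

definition orbit_simplices :: "'a list set \<Rightarrow> 'a list set" where
  "orbit_simplices S = {map ((\<otimes>) g) l | g l. g \<in> carrier G \<and> l \<in> S}"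

lemma orbit_simplicesI: "g \<in> carrier G \<Longrightarrow> l \<in> S \<Longrightarrow> map ((\<otimes>) g) l \<in> orbit_simplices S"
  unfolding orbit_simplices_def by blast

lemma keys_trans_orbit:
  assumes c: "Poly_Mapping.keys c \<subseteq> S" and g: "g \<in> carrier G"
  shows "Poly_Mapping.keys (trans_chain g c) \<subseteq> orbit_simplices S"
proof
  fix x assume "x \<in> Poly_Mapping.keys (trans_chain g c)"
  then have "x \<in> (\<Union>l\<in>Poly_Mapping.keys c. Poly_Mapping.keys (frag_of (map ((\<otimes>) g) l)))"
    by (rule subsetD[OF keys_frag_extend])
  then obtain l where l: "l \<in> Poly_Mapping.keys c" "x = map ((\<otimes>) g) l" by (auto simp: keys_frag_of)
  show "x \<in> orbit_simplices S"
    unfolding l(2) by (rule orbit_simplicesI[OF g subsetD[OF c l(1)]])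
qed

definition chain_hom :: "('m, 'c) monoid_scheme \<Rightarrow> ('a \<Rightarrow> 'm \<Rightarrow> 'm) \<Rightarrow> nat \<Rightarrow> ('m \<Rightarrow> 'a list \<Rightarrow>\<^sub>0 int) \<Rightarrow> bool" where
  "chain_hom P a k \<psi> \<longleftrightarrow> (\<forall>x\<in>carrier P. \<psi> x \<in> chains k) \<and>
     (\<forall>x\<in>carrier P. \<forall>y\<in>carrier P. \<psi> (x \<otimes>\<^bsub>P\<^esub> y) = \<psi> x + \<psi> y) \<and>
     (\<forall>g\<in>carrier G. \<forall>x\<in>carrier P. \<psi> (a g x) = trans_chain g (\<psi> x))"

lemma chain_homD:
  assumes "chain_hom P a k \<psi>"
  shows "x \<in> carrier P \<Longrightarrow> \<psi> x \<in> chains k"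
    "x \<in> carrier P \<Longrightarrow> y \<in> carrier P \<Longrightarrow> \<psi> (x \<otimes>\<^bsub>P\<^esub> y) = \<psi> x + \<psi> y"
    "g \<in> carrier G \<Longrightarrow> x \<in> carrier P \<Longrightarrow> \<psi> (a g x) = trans_chain g (\<psi> x)"
  using assms unfolding chain_hom_def by blast+

lemma chain_hom_comp:
  assumes "ZG_hom G P a Q b f" "chain_hom Q b k \<psi>"
  shows "chain_hom P a k (\<psi> \<circ> f)"
proof -
  have f: "f x \<in> carrier Q" "f (x \<otimes>\<^bsub>P\<^esub> y) = f x \<otimes>\<^bsub>Q\<^esub> f y" "g \<in> carrier G \<Longrightarrow> f (a g x) = b g (f x)"
    if "x \<in> carrier P" "y \<in> carrier P" for x y g
    using assms(1) that unfolding ZG_hom_def hom_def by auto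
  show ?thesis
    using f chain_homD[OF assms(2)] unfolding chain_hom_def by simp
qed

lemma free_carrier_iff:
  "f \<in> carrier (free_ZG G K) \<longleftrightarrow>
    finite {p. f p \<noteq> 0} \<and> {p. f p \<noteq> 0} \<subseteq> carrier G \<times> {..<K}"
  unfolding free_ZG_def by auto

lemma lookup_in_free:
  "Poly_Mapping.lookup d \<in> carrier (free_ZG G K) \<longleftrightarrow> Poly_Mapping.keys d \<subseteq> carrier G \<times> {..<K}"
  unfolding free_carrier_iff by (simp add: keys.rep_eq)

lemma free_ZG_mult: "f \<otimes>\<^bsub>free_ZG G K\<^esub> f' = (\<lambda>p. f p + f' p)"
  unfolding free_ZG_def by simp

text \<open>Translating the argument by \<open>inv g\<close> amounts to pushing the basis forward
  along left multiplication by \<open>g\<close>. As formal sums, elements of the free module admit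
  linear extension from basis elements.\<close>

lemma free_ZG_act_lookup:
  assumes g: "g \<in> carrier G" and d: "Poly_Mapping.keys d \<subseteq> carrier G \<times> {..<K}"
  shows "free_ZG_act G g (Poly_Mapping.lookup d)
    = Poly_Mapping.lookup (map_chain (\<lambda>(h, j). (g \<otimes> h, j)) d)"
  using d
proof (induction d rule: frag_induction)
  case zero
  show ?case by (auto simp: free_ZG_act_def fun_eq_iff)
next
  case (one p)
  obtain h j where p: "p = (h, j)" "h \<in> carrier G" using one by auto
  have "(h' \<in> carrier G \<and> inv g \<otimes> h' = h) \<longleftrightarrow> h' = g \<otimes> h" for h'
    using g p step_mult step_mult' by (metis m_closed)
  then show ?case using p by (auto simp: free_ZG_act_def fun_eq_iff)
next
  case (diff a b)
  have *: "free_ZG_act G g (Poly_Mapping.lookup (a - b))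
      = (\<lambda>p. free_ZG_act G g (Poly_Mapping.lookup a) p - free_ZG_act G g (Poly_Mapping.lookup b) p)"
    by (auto simp: free_ZG_act_def fun_eq_iff lookup_minus)
  show ?case
    unfolding * diff frag_extend_diff by (rule ext) (simp only: lookup_minus)
qed

text \<open>One step of the comparison theorem of homological algebra: fill the images of the basis
  elements by cones, extend equivariantly to the free module, restrict along \<open>i\<close> to its
  retract \<open>P\<close>. As the rank \<open>K\<close> is finite, all values are supported on
  finitely many orbits of simplices.\<close>

lemma chain_hom_lift:
  assumes P: "fg_projective G P a" and \<psi>: "chain_hom P a k \<psi>"
    and cycle: "\<And>x. x \<in> carrier P \<Longrightarrow> bd (\<psi> x) = 0"
  shows "\<exists>\<alpha> S. chain_hom P a (Suc k) \<alpha> \<and> (\<forall>x\<in>carrier P. bd (\<alpha> x) = \<psi> x) \<and>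
    finite S \<and> S \<subseteq> simplices (Suc k) \<and> (\<forall>x\<in>carrier P. Poly_Mapping.keys (\<alpha> x) \<subseteq> orbit_simplices S)"
proof -
  obtain K i p where i: "ZG_hom G P a (free_ZG G K) (free_ZG_act G) i"
    and p: "ZG_hom G (free_ZG G K) (free_ZG_act G) P a p"
    and pi: "\<And>x. x \<in> carrier P \<Longrightarrow> p (i x) = x"
    using P unfolding fg_projective_def by auto
  have M: "ZG_module G P a"
    by (rule P[unfolded fg_projective_def fin_gen_ZG_module_def, THEN conjunct1, THEN conjunct1])
  interpret Pm: comm_group P by (rule M[unfolded ZG_module_def, THEN conjunct2, THEN conjunct1])
  have iC: "i x \<in> carrier (free_ZG G K)" "i (x \<otimes>\<^bsub>P\<^esub> y) = (\<lambda>q. i x q + i y q)"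
      "g \<in> carrier G \<Longrightarrow> i (a g x) = free_ZG_act G g (i x)"
    if "x \<in> carrier P" "y \<in> carrier P" for x y g
    using i that unfolding ZG_hom_def hom_def by (auto simp: free_ZG_mult)
  define D where "D x = Abs_poly_mapping (i x)" for x
  have D: "Poly_Mapping.lookup (D x) = i x" if "x \<in> carrier P" for x
    unfolding D_def using iC(1)[OF that that] by (intro lookup_Abs_poly_mapping) (simp add: free_carrier_iff)
  have Dk: "Poly_Mapping.keys (D x) \<subseteq> carrier G \<times> {..<K}" if "x \<in> carrier P" for x
    using D[OF that] iC(1)[OF that that] lookup_in_free[of "D x" K] by simp
  define \<Psi> where "\<Psi> = \<psi> \<circ> p"
  have \<Psi>: "chain_hom (free_ZG G K) (free_ZG_act G) k \<Psi>"
    unfolding \<Psi>_def by (rule chain_hom_comp[OF p \<psi>])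
  have pC: "p f \<in> carrier P" if "f \<in> carrier (free_ZG G K)" for f
    using p that unfolding ZG_hom_def hom_def by auto
  define e where "e j = Poly_Mapping.lookup (frag_of (\<one>, j))" for j :: nat
  have eC: "e j \<in> carrier (free_ZG G K)" if "j < K" for j
    unfolding e_def lookup_in_free using that by simp
  \<comment> \<open>The cone with apex \<open>\<one>\<close> is not equivariant; it is taken on
    basis elements only, and \<open>E\<close> translates the result.\<close>
  define c where "c j = map_chain ((#) \<one>) (\<Psi> (e j))" for j
  have cC: "c j \<in> chains (Suc k)" if "j < K" for j
    unfolding c_def using chain_homD(1)[OF \<Psi> eC[OF that]] by (intro chains_cone) auto
  have bdc: "bd (c j) = \<Psi> (e j)" if "j < K" for j
    unfolding c_def bd_cone using cycle[OF pC[OF eC[OF that]]] by (simp add: \<Psi>_def)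
  define E where "E = frag_extend (\<lambda>(h, j). trans_chain h (c j))"
  have \<Psi>_diff: "\<Psi> (Poly_Mapping.lookup (x - y)) = \<Psi> (Poly_Mapping.lookup x) - \<Psi> (Poly_Mapping.lookup y)"
    if "Poly_Mapping.keys x \<subseteq> carrier G \<times> {..<K}" "Poly_Mapping.keys y \<subseteq> carrier G \<times> {..<K}" for x y
  proof -
    have xy: "Poly_Mapping.keys (x - y) \<subseteq> carrier G \<times> {..<K}" using keys_diff[of x y] that by blast
    have "Poly_Mapping.lookup (x - y) \<otimes>\<^bsub>free_ZG G K\<^esub> Poly_Mapping.lookup y = Poly_Mapping.lookup x"
      by (simp add: free_ZG_mult fun_eq_iff lookup_minus)
    then show ?thesis
      using chain_homD(2)[OF \<Psi>, of "Poly_Mapping.lookup (x - y)" "Poly_Mapping.lookup y"]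
        xy that by (simp add: lookup_in_free)
  qed
  have bdE: "bd (E d) = \<Psi> (Poly_Mapping.lookup d)" if "Poly_Mapping.keys d \<subseteq> carrier G \<times> {..<K}" for d
  proof -
    have "Poly_Mapping.keys d \<subseteq> carrier G \<times> {..<K} \<and> bd (E d) = \<Psi> (Poly_Mapping.lookup d)"
      using that
    proof (induction d rule: frag_induction)
      case zero
      have *: "\<Psi> (Poly_Mapping.lookup 0) = 0" using \<Psi>_diff[of 0 0] by simp
      show ?case unfolding E_def frag_extend_0 * by simp
    next
      case (one q)
      then obtain h j where q: "q = (h, j)" "h \<in> carrier G" "j < K" by auto
      have "free_ZG_act G h (e j) = Poly_Mapping.lookup (frag_of q)"
        unfolding e_def using free_ZG_act_lookup[OF q(2), of "frag_of (\<one>, j)" K] q by simp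
      then have "\<Psi> (Poly_Mapping.lookup (frag_of q)) = trans_chain h (\<Psi> (e j))"
        using chain_homD(3)[OF \<Psi> q(2) eC[OF q(3)]] by simp
      moreover have "bd (E (frag_of q)) = trans_chain h (bd (c j))"
        by (simp add: E_def q bd_map)
      ultimately show ?case using bdc q by simp
    next
      case (diff x y)
      then show ?case
        using \<Psi>_diff[of x y] keys_diff[of x y] by (auto simp: E_def frag_extend_diff)
    qed
    then show ?thesis ..
  qed
  define \<alpha> where "\<alpha> x = E (D x)" for x
  define S where "S = (\<Union>j<K. Poly_Mapping.keys (c j))"
  have "chain_hom P a (Suc k) \<alpha>"
    unfolding chain_hom_def
  proof (intro conjI ballI)
    fix x assume x: "x \<in> carrier P"
    show "\<alpha> x \<in> chains (Suc k)"
      unfolding \<alpha>_def E_def using Dk[OF x] cC by (intro chains_extend) (auto intro!: chains_trans)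
    fix y assume y: "y \<in> carrier P"
    have xy: "x \<otimes>\<^bsub>P\<^esub> y \<in> carrier P" using x y by (rule Pm.m_closed)
    have "D (x \<otimes>\<^bsub>P\<^esub> y) = D x + D y"
      using D[OF xy] D[OF x] D[OF y] iC(2)[OF x y] by (intro poly_mapping_eqI) (simp add: lookup_add)
    then show "\<alpha> (x \<otimes>\<^bsub>P\<^esub> y) = \<alpha> x + \<alpha> y" by (simp add: \<alpha>_def E_def frag_extend_add)
  next
    fix g x assume g: "g \<in> carrier G" and x: "x \<in> carrier P"
    have "a g \<in> hom P P" using M g unfolding ZG_module_def by simp
    then have gx: "a g x \<in> carrier P" using x by (rule hom_in_carrier)
    let ?T = "\<lambda>(h, j). (g \<otimes> h, j)"
    have "D (a g x) = map_chain ?T (D x)"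
      using D[OF gx] iC(3)[OF x x g] D[OF x] free_ZG_act_lookup[OF g Dk[OF x]]
      by (intro poly_mapping_eqI) simp
    then have "\<alpha> (a g x) = frag_extend (\<lambda>q. (\<lambda>(h, j). trans_chain h (c j)) (?T q)) (D x)"
      by (simp only: \<alpha>_def E_def frag_extend_map_chain)
    also have "\<dots> = frag_extend (\<lambda>q. trans_chain g ((\<lambda>(h, j). trans_chain h (c j)) q)) (D x)"
    proof (rule frag_extend_eq)
      fix q assume "q \<in> Poly_Mapping.keys (D x)"
      then obtain h j where q: "q = (h, j)" "h \<in> carrier G" "j < K" using Dk[OF x] by auto
      show "(\<lambda>(h, j). trans_chain h (c j)) (?T q) = trans_chain g ((\<lambda>(h, j). trans_chain h (c j)) q)"
        unfolding q(1) case_prod_conv by (rule trans_trans[OF cC[OF q(3)] g q(2), symmetric])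
    qed
    also have "\<dots> = trans_chain g (frag_extend (\<lambda>(h, j). trans_chain h (c j)) (D x))"
      by (rule frag_extend_frag_extend[symmetric])
    finally show "\<alpha> (a g x) = trans_chain g (\<alpha> x)" by (simp add: \<alpha>_def E_def)
  qed
  moreover have "\<forall>x\<in>carrier P. bd (\<alpha> x) = \<psi> x"
    using bdE[OF Dk] D pi by (simp add: \<alpha>_def \<Psi>_def)
  moreover have "finite S" by (simp add: S_def)
  moreover have "S \<subseteq> simplices (Suc k)" using cC by (auto simp: S_def chains_def)
  moreover have "\<forall>x\<in>carrier P. Poly_Mapping.keys (\<alpha> x) \<subseteq> orbit_simplices S"
  proof
    fix x assume x: "x \<in> carrier P"
    have "Poly_Mapping.keys (\<alpha> x)
        \<subseteq> (\<Union>q\<in>Poly_Mapping.keys (D x). Poly_Mapping.keys ((\<lambda>(h, j). trans_chain h (c j)) q))"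
      unfolding \<alpha>_def E_def by (rule keys_frag_extend)
    also have "\<dots> \<subseteq> orbit_simplices S"
    proof (rule UN_least)
      fix q assume "q \<in> Poly_Mapping.keys (D x)"
      then obtain h j where q: "q = (h, j)" "h \<in> carrier G" "j < K" using Dk[OF x] by auto
      have "Poly_Mapping.keys (c j) \<subseteq> S" using q(3) by (auto simp: S_def)
      then show "Poly_Mapping.keys ((\<lambda>(h, j). trans_chain h (c j)) q) \<subseteq> orbit_simplices S"
        unfolding q(1) case_prod_conv by (rule keys_trans_orbit[OF _ q(2)])
    qed
    finally show "Poly_Mapping.keys (\<alpha> x) \<subseteq> orbit_simplices S" .
  qed
  ultimately show ?thesis by blast
qed

text \<open>Chains on the one-point type stand in for the integers, so that linearity comes from
  \<open>frag_extend\<close>.\<close>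

definition cochain_eval :: "('a list \<Rightarrow> int) \<Rightarrow> ('a list \<Rightarrow>\<^sub>0 int) \<Rightarrow> int" where
  "cochain_eval f c = Poly_Mapping.lookup (frag_extend (\<lambda>l. frag_cmul (f l) (frag_of ())) c) ()"

lemma cochain_eval_simps [simp]:
  "cochain_eval f 0 = 0" "cochain_eval f (frag_of l) = f l"
  "cochain_eval f (c + d) = cochain_eval f c + cochain_eval f d"
  "cochain_eval f (c - d) = cochain_eval f c - cochain_eval f d"
  by (simp_all add: cochain_eval_def frag_extend_add frag_extend_diff lookup_add lookup_minus)

lemma cochain_eval_sum: "cochain_eval f (\<Sum>i<N. c i) = (\<Sum>i<N. cochain_eval f (c i))" for N :: nat
  by (induction N) simp_all

lemma cochain_eval_bd:
  assumes "\<And>l. l \<in> S \<Longrightarrow> cochain_eval f (simplex_bd l) = 0" "Poly_Mapping.keys c \<subseteq> S"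
  shows "cochain_eval f (bd c) = 0"
  using assms(2) by (induction c rule: frag_induction) (simp_all add: assms(1) frag_extend_diff)

text \<open>The chain maps from the projective resolution to the bar complex turn a loop, read as a
  1-cycle of the resolution, into the boundary of a 2-chain supported on the orbits of finitely
  many simplices; the homotopy \<open>\<tau>, \<sigma>\<close> compares this with the loop itself.\<close>

lemma FP2_loops_fill:
  assumes "FP2_in TYPE('m) G"
  shows "loops_fill G"
proof -
  obtain P0 :: "'m monoid" and a0 and P1 :: "'m monoid" and a1 and P2 :: "'m monoid"
    and a2 d1 d2 and \<epsilon> :: "'m \<Rightarrow> int" where res:
        "fg_projective G P0 a0 \<and> fg_projective G P1 a1 \<and> fg_projective G P2 a2 \<and>
        ZG_hom G P1 a1 P0 a0 d1 \<and> ZG_hom G P2 a2 P1 a1 d2 \<and>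
        (\<forall>x\<in>carrier P0. \<forall>y\<in>carrier P0. \<epsilon> (x \<otimes>\<^bsub>P0\<^esub> y) = \<epsilon> x + \<epsilon> y) \<and>
        (\<forall>g\<in>carrier G. \<forall>x\<in>carrier P0. \<epsilon> (a0 g x) = \<epsilon> x) \<and>
        (\<forall>z. \<exists>x\<in>carrier P0. \<epsilon> x = z) \<and>
        {x \<in> carrier P0. \<epsilon> x = 0} = d1 ` carrier P1 \<and>
        {x \<in> carrier P1. d1 x = \<one>\<^bsub>P0\<^esub>} = d2 ` carrier P2"
    using assms unfolding FP2_in_def by (elim exE)
  have proj: "fg_projective G P0 a0" "fg_projective G P1 a1" "fg_projective G P2 a2"
    and hom1: "ZG_hom G P1 a1 P0 a0 d1" and hom2: "ZG_hom G P2 a2 P1 a1 d2"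
    and \<epsilon>_add: "\<forall>x\<in>carrier P0. \<forall>y\<in>carrier P0. \<epsilon> (x \<otimes>\<^bsub>P0\<^esub> y) = \<epsilon> x + \<epsilon> y"
    and \<epsilon>_inv: "\<forall>g\<in>carrier G. \<forall>x\<in>carrier P0. \<epsilon> (a0 g x) = \<epsilon> x"
    and \<epsilon>_surj: "\<forall>z. \<exists>x\<in>carrier P0. \<epsilon> x = z"
    and ex0: "{x \<in> carrier P0. \<epsilon> x = 0} = d1 ` carrier P1"
    and ex1: "{x \<in> carrier P1. d1 x = \<one>\<^bsub>P0\<^esub>} = d2 ` carrier P2"
    by (insert res) (elim conjE, assumption)+
  have M: "ZG_module G P0 a0" "ZG_module G P1 a1" "ZG_module G P2 a2"
    by (rule proj[unfolded fg_projective_def fin_gen_ZG_module_def, THEN conjunct1, THEN conjunct1])+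
  interpret P0: comm_group P0 by (rule M(1)[unfolded ZG_module_def, THEN conjunct2, THEN conjunct1])
  interpret P1: comm_group P1 by (rule M(2)[unfolded ZG_module_def, THEN conjunct2, THEN conjunct1])
  have act0_hom: "a0 g \<in> hom P0 P0" if "g \<in> carrier G" for g
    using M(1) that unfolding ZG_module_def by simp
  have act1_hom: "a1 g \<in> hom P1 P1" if "g \<in> carrier G" for g
    using M(2) that unfolding ZG_module_def by simp
  have act0_mult: "a0 (g \<otimes> h) x = a0 g (a0 h x)"
    if "g \<in> carrier G" "h \<in> carrier G" "x \<in> carrier P0" for g h x
    using M(1) that unfolding ZG_module_def by simp
  have d1_hom: "d1 \<in> hom P1 P0" and d1_act: "\<And>g x. g \<in> carrier G \<Longrightarrow> x \<in> carrier P1 \<Longrightarrow> d1 (a1 g x) = a0 g (d1 x)"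
    using hom1 unfolding ZG_hom_def by auto
  note act0C = hom_in_carrier[OF act0_hom] and act1C = hom_in_carrier[OF act1_hom]
    and d1C = hom_in_carrier[OF d1_hom]

  \<comment> \<open>The lifting starts from the augmentation, read as a map to multiples of the
    empty simplex.\<close>
  have "chain_hom P0 a0 0 (\<lambda>x. frag_cmul (\<epsilon> x) (frag_of []))"
    unfolding chain_hom_def
    by (auto simp: \<epsilon>_add \<epsilon>_inv frag_cmul_distrib frag_extend_cmul simplices_def chains_of intro!: chains_cmul)
  from chain_hom_lift[OF proj(1) this]
  obtain \<alpha>0 where \<alpha>0: "chain_hom P0 a0 1 \<alpha>0"
    and bd0: "\<forall>x\<in>carrier P0. bd (\<alpha>0 x) = frag_cmul (\<epsilon> x) (frag_of [])"
    by (auto simp: frag_extend_cmul)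
  have "bd ((\<alpha>0 \<circ> d1) x) = 0" if "x \<in> carrier P1" for x
  proof -
    have "d1 x \<in> {x \<in> carrier P0. \<epsilon> x = 0}" unfolding ex0 using that by (rule imageI)
    then show ?thesis using bd0 by simp
  qed
  from chain_hom_lift[OF proj(2) chain_hom_comp[OF hom1 \<alpha>0] this]
  obtain \<alpha>1 where \<alpha>1: "chain_hom P1 a1 2 \<alpha>1" and bd1: "\<forall>x\<in>carrier P1. bd (\<alpha>1 x) = \<alpha>0 (d1 x)"
    by (auto simp: numeral_2_eq_2)
  have \<alpha>0_one: "\<alpha>0 \<one>\<^bsub>P0\<^esub> = 0"
    using chain_homD(2)[OF \<alpha>0 P0.one_closed P0.one_closed] by simp
  have d2k: "d2 x \<in> carrier P1 \<and> d1 (d2 x) = \<one>\<^bsub>P0\<^esub>" if "x \<in> carrier P2" for x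
  proof -
    have "d2 x \<in> {x \<in> carrier P1. d1 x = \<one>\<^bsub>P0\<^esub>}" unfolding ex1 using that by (rule imageI)
    then show ?thesis by simp
  qed
  have "bd ((\<alpha>1 \<circ> d2) x) = 0" if "x \<in> carrier P2" for x
    using d2k[OF that] bd1 \<alpha>0_one by simp
  from chain_hom_lift[OF proj(3) chain_hom_comp[OF hom2 \<alpha>1] this]
  obtain \<alpha>2 S where bd2: "\<forall>x\<in>carrier P2. bd (\<alpha>2 x) = \<alpha>1 (d2 x)"
    and S: "finite S" "S \<subseteq> simplices 3"
    and keys2: "\<forall>x\<in>carrier P2. Poly_Mapping.keys (\<alpha>2 x) \<subseteq> orbit_simplices S"
    by (auto simp: numeral_2_eq_2 numeral_3_eq_3)

  \<comment> \<open>\<open>u\<close> acts as a base vertex of the resolution and \<open>v f\<close>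
    as an edge from \<open>u\<close> to its translate: additively, \<open>d1 (v f)\<close> is
    \<open>f u - u\<close>.\<close>
  obtain u where u: "u \<in> carrier P0" "\<epsilon> u = 1" using \<epsilon>_surj by blast
  have "\<exists>v\<in>carrier P1. d1 v \<otimes>\<^bsub>P0\<^esub> u = a0 f u" if f: "f \<in> carrier G" for f
  proof -
    let ?x = "a0 f u \<otimes>\<^bsub>P0\<^esub> inv\<^bsub>P0\<^esub> u"
    have c: "?x \<in> carrier P0" using act0C[OF f u(1)] u by simp
    have e: "?x \<otimes>\<^bsub>P0\<^esub> u = a0 f u" using act0C[OF f u(1)] u by (simp add: P0.m_assoc)
    then have "\<epsilon> ?x + \<epsilon> u = \<epsilon> u" using \<epsilon>_add c u \<epsilon>_inv f by metis
    then have "?x \<in> d1 ` carrier P1" using c unfolding ex0[symmetric] by simp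
    then show ?thesis using e by auto
  qed
  then have "\<forall>f\<in>carrier G. \<exists>v. v \<in> carrier P1 \<and> d1 v \<otimes>\<^bsub>P0\<^esub> u = a0 f u" by blast
  from bchoice[OF this] obtain v where v: "\<And>f. f \<in> carrier G \<Longrightarrow> v f \<in> carrier P1"
    and d1v: "\<And>f. f \<in> carrier G \<Longrightarrow> d1 (v f) \<otimes>\<^bsub>P0\<^esub> u = a0 f u"
    by blast
  let ?cone = "map_chain ((#) \<one>)"
  \<comment> \<open>\<open>\<tau>\<close> joins the vertex \<open>[\<one>]\<close> to
    \<open>\<alpha>0 u\<close>; both have augmentation 1, so their difference is a cycle.\<close>
  define \<tau> where "\<tau> = ?cone (\<alpha>0 u - frag_of [\<one>])"
  have \<alpha>0uC: "\<alpha>0 u \<in> chains 1" by (rule chain_homD(1)[OF \<alpha>0 u(1)])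
  have \<tau>C: "\<tau> \<in> chains 2"
    using chains_cone[OF chains_diff[OF \<alpha>0uC, of "frag_of [\<one>]"] one_closed]
    by (simp add: \<tau>_def chains_of simplices_def numeral_2_eq_2)
  have bd\<tau>: "bd \<tau> = \<alpha>0 u - frag_of [\<one>]"
    unfolding \<tau>_def bd_cone using bd0 u by (simp add: frag_extend_diff)
  \<comment> \<open>The defect between \<open>\<alpha>1 (v f)\<close> and the true edge once their
    end points are joined by \<open>\<tau>\<close>: a cycle, hence filled by its cone
    \<open>\<sigma> f\<close>.\<close>
  define \<rho> where "\<rho> f = \<alpha>1 (v f) - frag_of [\<one>, f] - (trans_chain f \<tau> - \<tau>)" for f
  define \<sigma> where "\<sigma> f = ?cone (\<rho> f)" for f
  have \<rho>C: "\<rho> f \<in> chains 2" if f: "f \<in> carrier G" for f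
    unfolding \<rho>_def
    using chain_homD(1)[OF \<alpha>1 v[OF f]] chains_trans[OF \<tau>C f] \<tau>C f
    by (intro chains_diff) (auto simp: chains_of simplices_def)
  have bd\<rho>: "bd (\<rho> f) = 0" if f: "f \<in> carrier G" for f
  proof -
    have "\<alpha>0 (d1 (v f)) + \<alpha>0 u = trans_chain f (\<alpha>0 u)"
      using chain_homD(2)[OF \<alpha>0 d1C[OF v[OF f]] u(1)] chain_homD(3)[OF \<alpha>0 f u(1)] d1v[OF f] by simp
    then have "\<alpha>0 (d1 (v f)) = trans_chain f (\<alpha>0 u) - \<alpha>0 u" by (simp add: algebra_simps)
    then have "bd (\<alpha>1 (v f)) = trans_chain f (\<alpha>0 u) - \<alpha>0 u" using bd1 v[OF f] by simp
    moreover have "bd (trans_chain f \<tau>) = trans_chain f (\<alpha>0 u) - frag_of [f]"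
      unfolding bd_map bd\<tau> using f by (simp add: frag_extend_diff)
    ultimately show ?thesis
      unfolding \<rho>_def frag_extend_diff by (simp add: bd\<tau>)
  qed
  have bd\<sigma>: "bd (\<sigma> f) = \<rho> f" if "f \<in> carrier G" for f
    unfolding \<sigma>_def bd_cone using bd\<rho>[OF that] by simp
  have \<sigma>C: "\<sigma> f \<in> chains 3" if "f \<in> carrier G" for f
    using chains_cone[OF \<rho>C[OF that] one_closed] by (simp add: \<sigma>_def numeral_3_eq_3 numeral_2_eq_2)

  show ?thesis
    unfolding loops_fill_def
  proof (intro allI impI)
    fix A assume A: "finite A \<and> A \<subseteq> carrier G"
    \<comment> \<open>Besides the simplices of \<open>\<alpha>2\<close>, filling a loop needs only
      translates of \<open>\<sigma> f\<close> with \<open>f\<close> in the finite set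
      \<open>A\<close>.\<close>
    define S' where "S' = S \<union> (\<Union>f\<in>A. Poly_Mapping.keys (\<sigma> f))"
    have S'3: "S' \<subseteq> simplices 3" using S \<sigma>C A by (auto simp: S'_def chains_def)
    define Vt where "Vt = \<Union> (set ` S')"
    have Vt: "Vt \<subseteq> carrier G" using S'3 by (auto simp: Vt_def simplices_def)
    \<comment> \<open>Such quotients are invariant under left translation, so \<open>F\<close>
      contains the steps of all simplices in the orbits of \<open>S'\<close>.\<close>
    define F where "F = (\<lambda>(a, b). inv a \<otimes> b) ` (Vt \<times> Vt)"
    have "finite Vt" using A S by (simp add: Vt_def S'_def)
    then have F1: "finite F" by (simp add: F_def)
    have F2: "F \<subseteq> carrier G" using Vt by (auto simp: F_def)
    have key: "(\<Sum>i<N. \<omega> (\<gamma> i) (\<gamma> (Suc i))) = 0"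
      if \<omega>: "\<forall>a\<in>carrier G. \<forall>b\<in>carrier G. \<forall>c\<in>carrier G.
            inv a \<otimes> b \<in> F \<and> inv b \<otimes> c \<in> F \<longrightarrow> \<omega> a b + \<omega> b c = \<omega> a c"
        and \<gamma>: "(\<forall>i\<le>N. \<gamma> i \<in> carrier G) \<and> \<gamma> N = \<gamma> 0 \<and> (\<forall>i<N. inv (\<gamma> i) \<otimes> \<gamma> (Suc i) \<in> A)"
      for \<omega> :: "'a \<Rightarrow> 'a \<Rightarrow> int" and \<gamma> N
    proof -
      define f where "f i = inv (\<gamma> i) \<otimes> \<gamma> (Suc i)" for i
      have g: "\<gamma> i \<in> carrier G" if "i \<le> N" for i using \<gamma> that by simp
      have fA: "f i \<in> A" "f i \<in> carrier G" "\<gamma> i \<otimes> f i = \<gamma> (Suc i)" if "i < N" for i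
        using \<gamma> that A step_mult'[of "\<gamma> i" "\<gamma> (Suc i)"] by (auto simp: f_def)
      \<comment> \<open>\<open>V\<close> is the path up to \<open>\<gamma> k\<close> read in the
        resolution; \<open>B\<close> collects the fillings that compare \<open>\<alpha>1 V\<close>
        with the edge path.\<close>
      have main: "\<exists>V B. V \<in> carrier P1 \<and> d1 V \<otimes>\<^bsub>P0\<^esub> a0 (\<gamma> 0) u = a0 (\<gamma> k) u \<and>
          Poly_Mapping.keys B \<subseteq> orbit_simplices S' \<and>
          \<alpha>1 V = (\<Sum>i<k. frag_of [\<gamma> i, \<gamma> (Suc i)]) + trans_chain (\<gamma> k) \<tau> - trans_chain (\<gamma> 0) \<tau> + bd B"
        if "k \<le> N" for k
        using that
      proof (induction k)
        case 0
        have "d1 \<one>\<^bsub>P1\<^esub> = \<one>\<^bsub>P0\<^esub>" using hom_one[OF d1_hom] P1.is_group P0.is_group by simp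
        moreover have "\<alpha>1 \<one>\<^bsub>P1\<^esub> = 0"
          using chain_homD(2)[OF \<alpha>1 P1.one_closed P1.one_closed] by simp
        ultimately show ?case
          using act0C[OF g[of 0] u(1)] by (intro exI[of _ "\<one>\<^bsub>P1\<^esub>"] exI[of _ 0]) simp
      next
        case (Suc k)
        then have k: "k < N" by simp
        obtain V B where V: "V \<in> carrier P1" and dV: "d1 V \<otimes>\<^bsub>P0\<^esub> a0 (\<gamma> 0) u = a0 (\<gamma> k) u"
          and B: "Poly_Mapping.keys B \<subseteq> orbit_simplices S'"
          and \<alpha>V: "\<alpha>1 V = (\<Sum>i<k. frag_of [\<gamma> i, \<gamma> (Suc i)]) + trans_chain (\<gamma> k) \<tau>
             - trans_chain (\<gamma> 0) \<tau> + bd B"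
          using Suc by auto
        have gk: "\<gamma> k \<in> carrier G" "\<gamma> 0 \<in> carrier G" using g k by auto
        note fk = fA[OF k]
        let ?w = "a1 (\<gamma> k) (v (f k))"
        have wC: "?w \<in> carrier P1" using act1C[OF gk(1) v[OF fk(2)]] .
        have dw: "d1 ?w \<otimes>\<^bsub>P0\<^esub> a0 (\<gamma> k) u = a0 (\<gamma> (Suc k)) u"
          using d1_act[OF gk(1) v[OF fk(2)]] hom_mult[OF act0_hom[OF gk(1)] d1C[OF v[OF fk(2)]] u(1)]
            d1v[OF fk(2)] act0_mult[OF gk(1) fk(2) u(1)] fk(3) by simp
        have d0: "d1 V \<in> carrier P0" "d1 ?w \<in> carrier P0" "a0 (\<gamma> 0) u \<in> carrier P0"
          using d1C[OF V] d1C[OF wC] act0C[OF gk(2) u(1)] by auto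
        have "d1 (V \<otimes>\<^bsub>P1\<^esub> ?w) \<otimes>\<^bsub>P0\<^esub> a0 (\<gamma> 0) u = d1 ?w \<otimes>\<^bsub>P0\<^esub> (d1 V \<otimes>\<^bsub>P0\<^esub> a0 (\<gamma> 0) u)"
          unfolding hom_mult[OF d1_hom V wC] using d0 by (simp add: P0.m_ac)
        then have 1: "d1 (V \<otimes>\<^bsub>P1\<^esub> ?w) \<otimes>\<^bsub>P0\<^esub> a0 (\<gamma> 0) u = a0 (\<gamma> (Suc k)) u"
          unfolding dV dw .
        let ?B = "B + trans_chain (\<gamma> k) (\<sigma> (f k))"
        have "Poly_Mapping.keys (trans_chain (\<gamma> k) (\<sigma> (f k))) \<subseteq> orbit_simplices S'"
          using fk by (intro keys_trans_orbit gk(1)) (auto simp: S'_def)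
        then have 2: "Poly_Mapping.keys ?B \<subseteq> orbit_simplices S'"
          using B keys_add[of B "trans_chain (\<gamma> k) (\<sigma> (f k))"] by blast
        have "\<alpha>1 (v (f k)) = bd (\<sigma> (f k)) + frag_of [\<one>, f k] + (trans_chain (f k) \<tau> - \<tau>)"
          unfolding bd\<sigma>[OF fk(2)] \<rho>_def by simp
        then have "trans_chain (\<gamma> k) (\<alpha>1 (v (f k))) = bd (trans_chain (\<gamma> k) (\<sigma> (f k)))
            + frag_of [\<gamma> k, \<gamma> (Suc k)] + (trans_chain (\<gamma> (Suc k)) \<tau> - trans_chain (\<gamma> k) \<tau>)"
          using trans_trans[OF \<tau>C gk(1) fk(2)] fk(3) gk
          by (simp add: frag_extend_add frag_extend_diff bd_map)
        moreover have "\<alpha>1 (V \<otimes>\<^bsub>P1\<^esub> ?w) = \<alpha>1 V + trans_chain (\<gamma> k) (\<alpha>1 (v (f k)))"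
          unfolding chain_homD(2)[OF \<alpha>1 V wC] chain_homD(3)[OF \<alpha>1 gk(1) v[OF fk(2)]] ..
        ultimately have 3: "\<alpha>1 (V \<otimes>\<^bsub>P1\<^esub> ?w) = (\<Sum>i<Suc k. frag_of [\<gamma> i, \<gamma> (Suc i)])
            + trans_chain (\<gamma> (Suc k)) \<tau> - trans_chain (\<gamma> 0) \<tau> + bd ?B"
          unfolding \<alpha>V by (simp add: frag_extend_add algebra_simps)
        show ?case
          by (intro exI[of _ "V \<otimes>\<^bsub>P1\<^esub> ?w"] exI[of _ ?B] conjI 1 2 3 P1.m_closed[OF V wC])
      qed
      obtain V B where V: "V \<in> carrier P1" and dV: "d1 V \<otimes>\<^bsub>P0\<^esub> a0 (\<gamma> 0) u = a0 (\<gamma> N) u"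
        and B: "Poly_Mapping.keys B \<subseteq> orbit_simplices S'"
        and \<alpha>V: "\<alpha>1 V = (\<Sum>i<N. frag_of [\<gamma> i, \<gamma> (Suc i)]) + trans_chain (\<gamma> N) \<tau>
             - trans_chain (\<gamma> 0) \<tau> + bd B"
        using main[OF order_refl] by blast
      have gN: "\<gamma> N = \<gamma> 0" using \<gamma> by simp
      \<comment> \<open>The loop closes, so \<open>V\<close> is a cycle and by exactness a boundary;
        the two \<open>\<tau>\<close> terms in \<open>\<alpha>1 V\<close> cancel for the same
        reason.\<close>
      have "d1 V = \<one>\<^bsub>P0\<^esub>"
        using dV d1C[OF V] act0C[OF g[of 0] u(1)] P0.r_cancel_one[of "a0 (\<gamma> 0) u" "d1 V"]
        unfolding gN by simp
      then have "V \<in> d2 ` carrier P2" using V unfolding ex1[symmetric] by simp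
      then obtain p where p: "p \<in> carrier P2" "V = d2 p" by blast
      have cyc: "(\<Sum>i<N. frag_of [\<gamma> i, \<gamma> (Suc i)]) = bd (\<alpha>2 p - B)"
        using \<alpha>V bd2 p unfolding gN by (simp add: frag_extend_diff)
      define W where "W l = (if length l = 2 then \<omega> (l ! 0) (l ! 1) else 0)" for l
      have W: "cochain_eval W (simplex_bd l) = 0" if lO: "l \<in> orbit_simplices S'" for l
      proof -
        obtain h l' where l: "l = map ((\<otimes>) h) l'" "h \<in> carrier G" "l' \<in> S'"
          using lO unfolding orbit_simplices_def by blast
        then have "length l' = 3" using S'3 by (auto simp: simplices_def)
        then obtain x y z where l': "l' = [x, y, z]"
          by (auto simp: length_Suc_conv numeral_3_eq_3)
        have xyz: "x \<in> Vt" "y \<in> Vt" "z \<in> Vt" using l(3) unfolding l' Vt_def by (auto intro!: bexI[of _ "[x, y, z]"])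
        have st: "inv (h \<otimes> a) \<otimes> (h \<otimes> b) \<in> F" if ab: "a \<in> Vt" "b \<in> Vt" for a b
        proof -
          have c: "a \<in> carrier G" "b \<in> carrier G" using ab Vt by auto
          have "inv (h \<otimes> a) \<otimes> (h \<otimes> b) = inv a \<otimes> (inv h \<otimes> (h \<otimes> b))"
            using c l(2) by (simp add: inv_mult_group m_assoc)
          also have "\<dots> = inv a \<otimes> b" using step_mult[OF l(2) c(2)] by simp
          also have "\<dots> \<in> F" using ab by (auto simp: F_def)
          finally show ?thesis .
        qed
        have c: "h \<otimes> x \<in> carrier G" "h \<otimes> y \<in> carrier G" "h \<otimes> z \<in> carrier G"
          using xyz Vt l(2) by auto
        have "\<omega> (h \<otimes> x) (h \<otimes> y) + \<omega> (h \<otimes> y) (h \<otimes> z) = \<omega> (h \<otimes> x) (h \<otimes> z)"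
          using \<omega> c st xyz by blast
        then show ?thesis by (simp add: l l' W_def frag_extend_diff)
      qed
      have "orbit_simplices S \<subseteq> orbit_simplices S'" unfolding orbit_simplices_def S'_def by blast
      then have "Poly_Mapping.keys (\<alpha>2 p - B) \<subseteq> orbit_simplices S'"
        using keys_diff[of "\<alpha>2 p" B] B bspec[OF keys2 p(1)] by blast
      then have "cochain_eval W (bd (\<alpha>2 p - B)) = 0" by (intro cochain_eval_bd[of "orbit_simplices S'"] W)
      then have "(\<Sum>i<N. cochain_eval W (frag_of [\<gamma> i, \<gamma> (Suc i)])) = 0"
        unfolding cyc[symmetric] cochain_eval_sum .
      then show ?thesis by (simp add: W_def)
    qed
    show "\<exists>F. finite F \<and> F \<subseteq> carrier G \<and>
     (\<forall>\<omega> :: 'a \<Rightarrow> 'a \<Rightarrow> int.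
       (\<forall>a\<in>carrier G. \<forall>b\<in>carrier G. \<forall>c\<in>carrier G.
          inv a \<otimes> b \<in> F \<and> inv b \<otimes> c \<in> F \<longrightarrow> \<omega> a b + \<omega> b c = \<omega> a c) \<longrightarrow>
       (\<forall>\<gamma> N. (\<forall>i\<le>N. \<gamma> i \<in> carrier G) \<and> \<gamma> N = \<gamma> 0 \<and>
          (\<forall>i<N. inv (\<gamma> i) \<otimes> \<gamma> (Suc i) \<in> A) \<longrightarrow>
          (\<Sum>i<N. \<omega> (\<gamma> i) (\<gamma> (Suc i))) = 0))"
      by (intro exI[of _ F] conjI allI impI F1 F2) (rule key, assumption+)
  qed
qed

end

section \<open>Groups acting on twin buildings\<close>

lemma (in cox_building) panel_two:
  assumes x: "x \<in> C" "i < n" and card: "card (panel n m C \<delta> i x) \<ge> 3"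
  shows "\<exists>z\<in>C. \<exists>z'\<in>C. z \<noteq> z' \<and> \<delta> z x = cls [i] \<and> \<delta> z' x = cls [i]"
proof -
  let ?A = "{z \<in> C. \<delta> z x = cls [i]}"
  have c: "card (insert x ?A) \<ge> 3" using card panel_alt[OF x] by simp
  then have "finite (insert x ?A)" by (intro card_ge_0_finite) simp
  then have fin: "finite ?A" by simp
  have "\<not> card ?A \<le> Suc 0" using c card_insert_if[OF fin, of x] by (auto split: if_splits)
  then show ?thesis unfolding card_le_Suc0_iff_eq[OF fin] by blast
qed

context split_twin
begin

text \<open>Within a twin apartment a chamber has only one opposite. If \<open>g\<close> carries the
  apartment of \<open>(c0, d0)\<close> to that of \<open>(c, d)\<close> and \<open>c0\<close> to
  \<open>c\<close>, then \<open>\<phi> g d0\<close> lies in the latter and is opposite to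
  \<open>c\<close>, hence equals \<open>d\<close>.\<close>

lemma opposite_transitive:
  assumes act: "twin_building_action G \<phi> Cp Cm dp dm ds"
    and strans: "strongly_transitive n m G \<phi> Cp Cm dp dm ds"
    and c0: "c0 \<in> Cp" "d0 \<in> Cm" "ds c0 d0 = cls []"
    and c: "c \<in> Cp" "d \<in> Cm" "ds c d = cls []"
  shows "\<exists>g\<in>carrier G. \<phi> g c0 = c \<and> \<phi> g d0 = d"
proof -
  let ?T = "twin_apartment_of n m Cp Cm dp dm ds"
  have T: "twin_apartment n m Cp Cm dp dm ds (?T c d) \<and> c \<in> ?T c d \<and> d \<in> ?T c d"
    if "c \<in> Cp" "d \<in> Cm" "ds c d = cls []" for c d
  proof -
    have "ds d c = cls []" using codist_swap[OF that(1,2), of "[]"] that by simp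
    moreover have "dp c c = cls []" "dm d d = cls []"
      using that plus.dist_one[of c c] minus.dist_one[of d d] by auto
    moreover have "twin_apartment n m Cp Cm dp dm ds (?T c d)"
      unfolding twin_apartment_def cox_one_def using that by blast
    ultimately show ?thesis using that unfolding twin_apartment_of_def by simp
  qed
  obtain g where g: "g \<in> carrier G" "\<phi> g ` ?T c0 d0 = ?T c d" "\<phi> g c0 = c"
    using strans[unfolded strongly_transitive_def, rule_format, of "?T c0 d0" c0 "?T c d" c]
      T[OF c0] T[OF c] c0 c by auto
  have gd: "\<phi> g d0 \<in> Cm" "ds (\<phi> g c0) (\<phi> g d0) = ds c0 d0"
    using act[unfolded twin_building_action_def] g(1) c0 by (auto dest: bij_betw_apply)
  have "\<phi> g d0 \<in> ?T c d" using T[OF c0] g(2) by blast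
  then have "dm d (\<phi> g d0) = ds c (\<phi> g d0)"
    using gd(1) twin_parts(1) unfolding twin_apartment_of_def by blast
  then have "dm d (\<phi> g d0) = cls []" using gd(2) g(3) c0 by simp
  then show ?thesis using g minus.dist_one[OF c(2) gd(1)] by blast
qed

lemma not_loops_fill:
  fixes G :: "('g, 'b) monoid_scheme"
  assumes panels: "\<And>i. i < n \<Longrightarrow> q i \<ge> (2 :: nat) \<and>
        (\<forall>c\<in>Cp. card (panel n m Cp dp i c) = q i + 1) \<and>
        (\<forall>c\<in>Cm. card (panel n m Cm dm i c) = q i + 1)"
    and act: "twin_building_action G \<phi> Cp Cm dp dm ds"
    and strans: "strongly_transitive n m G \<phi> Cp Cm dp dm ds"
    and c0: "c0 \<in> Cp" and d0: "d0 \<in> Cm" and opp: "ds c0 d0 = cls []"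
    and T_fin: "finite {g \<in> carrier G. \<phi> g c0 = c0 \<and> \<phi> g d0 = d0}"
  shows "\<not> loops_fill G"
proof
  assume "loops_fill G"
  have group: "group G"
    and bij: "\<forall>g\<in>carrier G. bij_betw (\<phi> g) Cp Cp \<and> bij_betw (\<phi> g) Cm Cm"
    and act_one: "\<forall>x\<in>Cp \<union> Cm. \<phi> \<one>\<^bsub>G\<^esub> x = x"
    and act_mult: "\<forall>g\<in>carrier G. \<forall>h\<in>carrier G. \<forall>x\<in>Cp \<union> Cm. \<phi> (g \<otimes>\<^bsub>G\<^esub> h) x = \<phi> g (\<phi> h x)"
    and act_dp: "\<forall>g\<in>carrier G. \<forall>x\<in>Cp. \<forall>y\<in>Cp. dp (\<phi> g x) (\<phi> g y) = dp x y"
    and act_dm: "\<forall>g\<in>carrier G. \<forall>x\<in>Cm. \<forall>y\<in>Cm. dm (\<phi> g x) (\<phi> g y) = dm x y"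
    and act_ds: "\<forall>g\<in>carrier G. \<forall>x\<in>Cp. \<forall>y\<in>Cm. ds (\<phi> g x) (\<phi> g y) = ds x y \<and> ds (\<phi> g y) (\<phi> g x) = ds y x"
    by (insert act[unfolded twin_building_action_def]) (elim conjE, assumption)+
  interpret G: group G by (rule group)
  have pC: "\<phi> g x \<in> Cp" if "g \<in> carrier G" "x \<in> Cp" for g x
    using bij that by (blast intro: bij_betw_apply)
  have mC: "\<phi> g x \<in> Cm" if "g \<in> carrier G" "x \<in> Cm" for g x
    using bij that by (blast intro: bij_betw_apply)
  have undo: "\<phi> (inv\<^bsub>G\<^esub> g) (\<phi> g x) = x" if "g \<in> carrier G" "x \<in> Cp \<union> Cm" for g x
  proof -
    have "\<phi> (inv\<^bsub>G\<^esub> g \<otimes>\<^bsub>G\<^esub> g) x = \<phi> (inv\<^bsub>G\<^esub> g) (\<phi> g x)"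
      using act_mult that G.inv_closed[OF that(1)] by blast
    then show ?thesis using act_one that by simp
  qed
  have dp_step: "dp (\<phi> (inv\<^bsub>G\<^esub> g \<otimes>\<^bsub>G\<^esub> h) c0) c0 = dp (\<phi> h c0) (\<phi> g c0)"
    if gh: "g \<in> carrier G" "h \<in> carrier G" for g h
  proof -
    have "\<phi> (inv\<^bsub>G\<^esub> g \<otimes>\<^bsub>G\<^esub> h) c0 = \<phi> (inv\<^bsub>G\<^esub> g) (\<phi> h c0)" using act_mult gh c0 by simp
    moreover have "dp (\<phi> (inv\<^bsub>G\<^esub> g) (\<phi> h c0)) (\<phi> (inv\<^bsub>G\<^esub> g) (\<phi> g c0)) = dp (\<phi> h c0) (\<phi> g c0)"
      using act_dp gh pC c0 by simp
    ultimately show ?thesis using undo[of g c0] gh c0 by simp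
  qed
  have dp_step': "dp c0 (\<phi> (inv\<^bsub>G\<^esub> g \<otimes>\<^bsub>G\<^esub> h) c0) = dp (\<phi> g c0) (\<phi> h c0)"
    if gh: "g \<in> carrier G" "h \<in> carrier G" for g h
  proof -
    have "\<phi> (inv\<^bsub>G\<^esub> g \<otimes>\<^bsub>G\<^esub> h) c0 = \<phi> (inv\<^bsub>G\<^esub> g) (\<phi> h c0)" using act_mult gh c0 by simp
    moreover have "dp (\<phi> (inv\<^bsub>G\<^esub> g) (\<phi> g c0)) (\<phi> (inv\<^bsub>G\<^esub> g) (\<phi> h c0)) = dp (\<phi> g c0) (\<phi> h c0)"
      using act_dp gh pC c0 by simp
    ultimately show ?thesis using undo[of g c0] gh c0 by simp
  qed
  have dm_step: "dm (\<phi> (inv\<^bsub>G\<^esub> g \<otimes>\<^bsub>G\<^esub> h) d0) d0 = dm (\<phi> h d0) (\<phi> g d0)"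
    if gh: "g \<in> carrier G" "h \<in> carrier G" for g h
  proof -
    have "\<phi> (inv\<^bsub>G\<^esub> g \<otimes>\<^bsub>G\<^esub> h) d0 = \<phi> (inv\<^bsub>G\<^esub> g) (\<phi> h d0)" using act_mult gh d0 by simp
    moreover have "dm (\<phi> (inv\<^bsub>G\<^esub> g) (\<phi> h d0)) (\<phi> (inv\<^bsub>G\<^esub> g) (\<phi> g d0)) = dm (\<phi> h d0) (\<phi> g d0)"
      using act_dm gh mC d0 by simp
    ultimately show ?thesis using undo[of g d0] gh d0 by simp
  qed

  \<comment> \<open>The finite step set \<open>A\<close>\<close>
  define Np where "Np = {z \<in> Cp. \<exists>i<n. dp z c0 = cls [i]}"
  define Nm where "Nm = {z \<in> Cm. \<exists>i<n. dm z d0 = cls [i]}"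
  have "finite (panel n m Cp dp i c0)" "finite (panel n m Cm dm i d0)" if "i < n" for i
    using panels[OF that] c0 d0 by (auto intro!: card_ge_0_finite)
  then have "finite (\<Union>i<n. panel n m Cp dp i c0)" "finite (\<Union>i<n. panel n m Cm dm i d0)" by auto
  moreover have "Np \<subseteq> (\<Union>i<n. panel n m Cp dp i c0)"
    using plus.panel_alt[OF c0] by (auto simp: Np_def)
  moreover have "Nm \<subseteq> (\<Union>i<n. panel n m Cm dm i d0)"
    using minus.panel_alt[OF d0] by (auto simp: Nm_def)
  ultimately have fN: "finite (Np \<times> Nm)" using finite_subset by blast
  \<comment> \<open>The set is empty or a coset of the finite stabilizer of
    \<open>(c0, d0)\<close>.\<close>
  have fib: "finite {g \<in> carrier G. \<phi> g c0 = c \<and> \<phi> g d0 = d}" for c d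
  proof (cases "\<exists>g1\<in>carrier G. \<phi> g1 c0 = c \<and> \<phi> g1 d0 = d")
    case True
    then obtain g1 where g1: "g1 \<in> carrier G" "\<phi> g1 c0 = c" "\<phi> g1 d0 = d" by blast
    have "{g \<in> carrier G. \<phi> g c0 = c \<and> \<phi> g d0 = d}
        \<subseteq> (\<lambda>h. g1 \<otimes>\<^bsub>G\<^esub> h) ` {g \<in> carrier G. \<phi> g c0 = c0 \<and> \<phi> g d0 = d0}"
    proof
      fix g assume g: "g \<in> {g \<in> carrier G. \<phi> g c0 = c \<and> \<phi> g d0 = d}"
      let ?h = "inv\<^bsub>G\<^esub> g1 \<otimes>\<^bsub>G\<^esub> g"
      have "\<phi> ?h c0 = \<phi> (inv\<^bsub>G\<^esub> g1) (\<phi> g c0)" "\<phi> ?h d0 = \<phi> (inv\<^bsub>G\<^esub> g1) (\<phi> g d0)"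
        using act_mult g g1 c0 d0 by auto
      then have "\<phi> ?h c0 = c0" "\<phi> ?h d0 = d0"
        using g g1 undo[of g1 c0] undo[of g1 d0] c0 d0 by auto
      moreover have "g = g1 \<otimes>\<^bsub>G\<^esub> ?h" using G.step_mult'[of g1 g] g g1 by simp
      ultimately show "g \<in> (\<lambda>h. g1 \<otimes>\<^bsub>G\<^esub> h) ` {g \<in> carrier G. \<phi> g c0 = c0 \<and> \<phi> g d0 = d0}"
        using g g1 by blast
    qed
    then show ?thesis using T_fin by (rule finite_surj[rotated])
  next
    case False
    then have *: "{g \<in> carrier G. \<phi> g c0 = c \<and> \<phi> g d0 = d} = {}" by blast
    show ?thesis unfolding * by simp
  qed
  define A where "A = {g \<in> carrier G. \<phi> g c0 \<in> Np \<and> \<phi> g d0 \<in> Nm}"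
  have "A = (\<Union>(c, d)\<in>Np \<times> Nm. {g \<in> carrier G. \<phi> g c0 = c \<and> \<phi> g d0 = d})"
    by (auto simp: A_def)
  also have "finite \<dots>" using fN fib by (intro finite_UN_I) auto
  finally have A: "finite A \<and> A \<subseteq> carrier G" by (auto simp: A_def)
  obtain F where F: "finite F" "F \<subseteq> carrier G"
    and fill: "\<forall>\<omega> :: 'g \<Rightarrow> 'g \<Rightarrow> int.
       (\<forall>a\<in>carrier G. \<forall>b\<in>carrier G. \<forall>c\<in>carrier G.
          inv\<^bsub>G\<^esub> a \<otimes>\<^bsub>G\<^esub> b \<in> F \<and> inv\<^bsub>G\<^esub> b \<otimes>\<^bsub>G\<^esub> c \<in> F \<longrightarrow> \<omega> a b + \<omega> b c = \<omega> a c) \<longrightarrow>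
       (\<forall>\<gamma> N. (\<forall>i\<le>N. \<gamma> i \<in> carrier G) \<and> \<gamma> N = \<gamma> 0 \<and>
          (\<forall>i<N. inv\<^bsub>G\<^esub> (\<gamma> i) \<otimes>\<^bsub>G\<^esub> \<gamma> (Suc i) \<in> A) \<longrightarrow>
          (\<Sum>i<N. \<omega> (\<gamma> i) (\<gamma> (Suc i))) = 0)"
    using \<open>loops_fill G\<close>[unfolded loops_fill_def, rule_format, OF A] by blast

  \<comment> \<open>Constants and the rays of the diamond\<close>
  define r where "r = (\<Sum>f\<in>F. len (dp c0 (\<phi> f c0)) + len (dm (\<phi> f d0) d0))"
  have r: "len (dp c0 (\<phi> f c0)) \<le> r" "len (dm (\<phi> f d0) d0) \<le> r" if "f \<in> F" for f
    using member_le_sum[of f F "\<lambda>f. len (dp c0 (\<phi> f c0)) + len (dm (\<phi> f d0) d0)"] that F(1)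
    unfolding r_def by auto
  obtain Mp where Mp: "\<forall>E\<in>Cp. \<forall>x\<in>Cp. \<forall>y\<in>Cp. \<forall>w. wrd w \<and> dp x y = cls w \<and>
      plus.halftree E x \<noteq> plus.halftree E y \<longrightarrow> len (dp y E) \<le> length w + Mp"
    using plus.halftree_change by blast
  obtain Mm where Mm: "\<forall>E\<in>Cm. \<forall>x\<in>Cm. \<forall>y\<in>Cm. \<forall>w. wrd w \<and> dm x y = cls w \<and>
      minus.halftree E x \<noteq> minus.halftree E y \<longrightarrow> len (dm y E) \<le> length w + Mm"
    using minus.halftree_change by blast
  \<comment> \<open>Odd for \<open>codist_rays\<close>. The base chambers, one step into the rays,
    have codistance of length \<open>L - 2\<close>, which must exceed the
    \<open>2 * r + Mp + Mm\<close> that a violated cocycle identity would force.\<close>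
  define L where "L = 2 * (r + r + Mp + Mm) + 5"
  have L: "odd L" "L \<ge> 5" "L - 2 > (r + Mp) + (r + Mm)" by (auto simp: L_def)
  obtain p where p: "p \<in> Cp" "ds p d0 = cls (alt_word s t L)"
    using ex_codist[OF c0 d0 opp, of 0 L] by auto

  have two_p: "\<exists>z\<in>Cp. \<exists>z'\<in>Cp. z \<noteq> z' \<and> dp z x = cls [i] \<and> dp z' x = cls [i]"
    if "x \<in> Cp" "i < n" for x i
    using plus.panel_two[OF that] panels[OF that(2)] that(1) by fastforce
  have two_m: "\<exists>z\<in>Cm. \<exists>z'\<in>Cm. z \<noteq> z' \<and> dm z x = cls [i] \<and> dm z' x = cls [i]"
    if "x \<in> Cm" "i < n" for x i
    using minus.panel_two[OF that] panels[OF that(2)] that(1) by fastforce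
  have s: "s < n" using letter_lt[of 0] by simp
  have ray_p: "\<exists>x. plus.ray x \<and> x 0 = p \<and> x (Suc 0) = z" if "z \<in> Cp" "dp z p = cls [s]" for z
    using plus.ex_ray[OF _ p(1) that] two_p by meson
  have ray_m: "\<exists>y. minus.ray y \<and> y 0 = d0 \<and> y (Suc 0) = z" if "z \<in> Cm" "dm z d0 = cls [s]" for z
    using minus.ex_ray[OF _ d0 that] two_m by meson
  \<comment> \<open>Thickness gives two rays from the same chamber that part at their first
    step.\<close>
  obtain x1 x2 where x: "plus.ray x1" "plus.ray x2" "x1 0 = p" "x2 0 = p" "x1 (Suc 0) \<noteq> x2 (Suc 0)"
    using two_p[OF p(1) s] ray_p by metis
  obtain y1 y2 where y: "minus.ray y1" "minus.ray y2" "y1 0 = d0" "y2 0 = d0" "y1 (Suc 0) \<noteq> y2 (Suc 0)"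
    using two_m[OF d0 s] ray_m by metis
  define E where "E = x1 (Suc 0)"
  define E' where "E' = y1 (Suc 0)"
  have EC: "E \<in> Cp" "E' \<in> Cm"
    using plus.ray_C[OF x(1)] minus.ray_C[OF y(1)] by (auto simp: E_def E'_def)
  define h where "h = plus.halftree E"
  define k where "k = minus.halftree E'"
  have h1: "h (x1 a) = (if a \<ge> 2 then 1 else 0)" for a
    unfolding h_def E_def by (rule plus.halftree_ray[OF x(1)])
  have h2: "h (x2 a) = 0" for a
    unfolding h_def E_def using x by (intro plus.halftree_other_ray) auto
  have k1: "k (y1 a) = (if a \<ge> 2 then 1 else 0)" for a
    unfolding k_def E'_def by (rule minus.halftree_ray[OF y(1)])
  have k2: "k (y2 a) = 0" for a
    unfolding k_def E'_def using y by (intro minus.halftree_other_ray) auto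
  have far: "len (ds E E') = L - 2"
    using codist_rays[OF x(1) y(1) L(1), of 1 1] x y p L len_alt[of 1 "L - 2"]
    by (simp add: E_def E'_def numeral_2_eq_2)

  \<comment> \<open>The cochain and its cocycle identity on steps in \<open>F\<close>\<close>
  define \<omega> where "\<omega> a b = h (\<phi> a c0) * (k (\<phi> b d0) - k (\<phi> a d0))" for a b
  have cocycle: "\<omega> a b + \<omega> b c = \<omega> a c"
    if abc: "a \<in> carrier G" "b \<in> carrier G" "c \<in> carrier G"
      and ab: "inv\<^bsub>G\<^esub> a \<otimes>\<^bsub>G\<^esub> b \<in> F" and bc: "inv\<^bsub>G\<^esub> b \<otimes>\<^bsub>G\<^esub> c \<in> F" for a b c
  proof -
    let ?c = "\<phi> b c0" and ?d = "\<phi> b d0"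
    have C: "\<phi> a c0 \<in> Cp" "?c \<in> Cp" "?d \<in> Cm" "\<phi> c d0 \<in> Cm" using pC mC abc c0 d0 by auto
    have "h (\<phi> a c0) = h ?c \<or> k (\<phi> c d0) = k ?d"
    proof (rule ccontr)
      assume "\<not> ?thesis"
      then have hk: "h (\<phi> a c0) \<noteq> h ?c" "k (\<phi> c d0) \<noteq> k ?d" by auto
      \<comment> \<open>\<open>halftree_change\<close> bounds the distance at the end of the path,
        so both paths are made to end at \<open>b\<close>: this one runs from \<open>a\<close>, the
        one for \<open>k\<close> from \<open>c\<close>.\<close>
      have 1: "len (dp ?c E) \<le> r + Mp"
      proof -
        obtain w where w: "wrd w" "dp (\<phi> a c0) ?c = cls w" using plus.dist_ex C by blast
        obtain v where v: "wrd v" "v \<doteq> w" "length v = len (cls w)" using len_ex[OF w(1)] by blast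
        have "dp (\<phi> a c0) ?c = cls v" using w v cls_eq[of v w] by simp
        then have "len (dp ?c E) \<le> length v + Mp"
          using Mp EC(1) C(1,2) v(1) hk(1) unfolding h_def by blast
        moreover have "length v \<le> r" using r(1)[OF ab] dp_step'[OF abc(1,2)] w v by simp
        ultimately show ?thesis by simp
      qed
      have 2: "len (dm ?d E') \<le> r + Mm"
      proof -
        obtain w where w: "wrd w" "dm (\<phi> c d0) ?d = cls w" using minus.dist_ex C by blast
        obtain v where v: "wrd v" "v \<doteq> w" "length v = len (cls w)" using len_ex[OF w(1)] by blast
        have "dm (\<phi> c d0) ?d = cls v" using w v cls_eq[of v w] by simp
        then have "len (dm ?d E') \<le> length v + Mm"
          using Mm EC(2) C(3,4) v(1) hk(2) unfolding k_def by blast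
        moreover have "length v \<le> r" using r(2)[OF bc] dm_step[OF abc(2,3)] w v by simp
        ultimately show ?thesis by simp
      qed
      \<comment> \<open>\<open>?c\<close> and \<open>?d\<close> are opposite, so walking from
        \<open>?c\<close> to \<open>E\<close> and then from \<open>?d\<close> to \<open>E'\<close>
        raises the codistance from 0 by no more than the two bounds.\<close>
      have 3: "len (ds E ?d) \<le> r + Mp"
      proof -
        obtain w where w: "wrd w" "dp ?c E = cls w" using plus.dist_ex C EC by blast
        obtain v where v: "wrd v" "v \<doteq> w" "length v = len (cls w)" using len_ex[OF w(1)] by blast
        have "dp ?c E = cls v" using w v cls_eq[of v w] by simp
        then have "len (ds E ?d) \<le> len (ds ?c ?d) + length v"
          by (intro plus.gallery[of "\<lambda>x. len (ds x ?d)"] plus.codist_lipschitz C EC v)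
        moreover have "len (ds ?c ?d) = 0" using act_ds abc c0 d0 opp by simp
        ultimately show ?thesis using 1 v w by simp
      qed
      have "len (ds E' E) \<le> (r + Mp) + (r + Mm)"
      proof -
        obtain w where w: "wrd w" "dm ?d E' = cls w" using minus.dist_ex C EC by blast
        obtain v where v: "wrd v" "v \<doteq> w" "length v = len (cls w)" using len_ex[OF w(1)] by blast
        have "dm ?d E' = cls v" using w v cls_eq[of v w] by simp
        then have "len (ds E' E) \<le> len (ds ?d E) + length v"
          by (intro minus.gallery[of "\<lambda>x. len (ds x E)"] minus.codist_lipschitz C EC v)
        moreover have "len (ds ?d E) = len (ds E ?d)" using len_codist_swap[OF EC(1) C(3)] by simp
        ultimately show ?thesis using 2 3 v w by simp
      qed
      then show False using far L(3) len_codist_swap[OF EC] by simp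
    qed
    then show ?thesis by (auto simp: \<omega>_def algebra_simps)
  qed

  \<comment> \<open>The loop of opposite pairs around the diamond\<close>
  define xi where "xi i = (if i \<le> L then x1 (L - i) else if i \<le> 2 * L then x2 (i - L)
      else if i \<le> 3 * L then x2 (3 * L - i) else x1 (i - 3 * L))" for i
  \<comment> \<open>The positions on the two rays always add up to \<open>L\<close>, which makes the
    pairs opposite. \<open>xi\<close> changes rays at \<open>p\<close>, for \<open>i = L\<close> and
    \<open>i = 3 * L\<close>; \<open>yi\<close> changes rays at \<open>d0\<close>, for
    \<open>i = 2 * L\<close> and when the loop closes.\<close>
  define yi where "yi i = (if i \<le> L then y1 i else if i \<le> 2 * L then y1 (2 * L - i)
      else if i \<le> 3 * L then y2 (i - 2 * L) else y2 (4 * L - i))" for i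
  have xiC: "xi i \<in> Cp" for i using plus.ray_C x by (simp add: xi_def)
  have yiC: "yi i \<in> Cm" for i using minus.ray_C y by (simp add: yi_def)
  have opp_rays: "ds (x' a) (y' b) = cls []"
    if "plus.ray x'" "minus.ray y'" "x' 0 = p" "y' 0 = d0" "a + b = L" for x' y' a b
    using codist_rays[OF that(1,2) L(1), of a b] that p by simp
  have opp_i: "ds (xi i) (yi i) = cls []" if "i \<le> 4 * L" for i
  proof -
    consider "i \<le> L" | "L < i" "i \<le> 2 * L" | "2 * L < i" "i \<le> 3 * L" | "3 * L < i" by linarith
    then show ?thesis
    proof cases
      case 1
      then show ?thesis
        using opp_rays[OF x(1) y(1) x(3) y(3), of "L - i" i] by (simp add: xi_def yi_def)
    next
      case 2
      then show ?thesis
        using opp_rays[OF x(2) y(1) x(4) y(3), of "i - L" "2 * L - i"] by (simp add: xi_def yi_def)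
    next
      case 3
      then show ?thesis
        using opp_rays[OF x(2) y(2) x(4) y(4), of "3 * L - i" "i - 2 * L"] by (simp add: xi_def yi_def)
    next
      case 4
      then show ?thesis
        using opp_rays[OF x(1) y(2) x(3) y(4), of "i - 3 * L" "4 * L - i"] that
        by (simp add: xi_def yi_def)
    qed
  qed
  have adj_p: "\<exists>j<n. dp (x' a) (x' b) = cls [j]"
    if "plus.ray x'" "a = Suc b \<or> b = Suc a" for x' a b
  proof -
    have "dp (x' (Suc c)) (x' c) = cls [letter c]" for c using that(1) unfolding plus.ray_def by blast
    then show ?thesis
      using that(2) plus.adj_sym[OF plus.ray_C[OF that(1)] plus.ray_C[OF that(1)] letter_lt] letter_lt
      by blast
  qed
  have adj_m: "\<exists>j<n. dm (y' a) (y' b) = cls [j]"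
    if "minus.ray y'" "a = Suc b \<or> b = Suc a" for y' a b
  proof -
    have "dm (y' (Suc c)) (y' c) = cls [letter c]" for c using that(1) unfolding minus.ray_def by blast
    then show ?thesis
      using that(2) minus.adj_sym[OF minus.ray_C[OF that(1)] minus.ray_C[OF that(1)] letter_lt] letter_lt
      by blast
  qed
  have xi_adj: "\<exists>j<n. dp (xi (Suc i)) (xi i) = cls [j]" if "i < 4 * L" for i
  proof -
    consider "i < L" | "L \<le> i" "i < 2 * L" | "2 * L \<le> i" "i < 3 * L" | "3 * L \<le> i" by linarith
    then show ?thesis
    proof cases
      case 1
      then have "xi i = x1 (L - i)" "xi (Suc i) = x1 (L - Suc i)" by (auto simp: xi_def)
      moreover have "L - Suc i = Suc (L - i) \<or> L - i = Suc (L - Suc i)" using 1 that by arith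
      ultimately show ?thesis using adj_p[OF x(1)] by simp
    next
      case 2
      then have "xi i = x2 (i - L)" "xi (Suc i) = x2 (Suc i - L)" using x by (auto simp: xi_def)
      moreover have "Suc i - L = Suc (i - L) \<or> i - L = Suc (Suc i - L)" using 2 that by arith
      ultimately show ?thesis using adj_p[OF x(2)] by simp
    next
      case 3
      then have "xi i = x2 (3 * L - i)" "xi (Suc i) = x2 (3 * L - Suc i)"
        using L(2) by (auto simp: xi_def)
      moreover have "3 * L - Suc i = Suc (3 * L - i) \<or> 3 * L - i = Suc (3 * L - Suc i)" using 3 that by arith
      ultimately show ?thesis using adj_p[OF x(2)] by simp
    next
      case 4
      then have "xi i = x1 (i - 3 * L)" "xi (Suc i) = x1 (Suc i - 3 * L)"
        using L(2) x by (auto simp: xi_def)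
      moreover have "Suc i - 3 * L = Suc (i - 3 * L) \<or> i - 3 * L = Suc (Suc i - 3 * L)" using 4 that by arith
      ultimately show ?thesis using adj_p[OF x(1)] by simp
    qed
  qed
  have yi_adj: "\<exists>j<n. dm (yi (Suc i)) (yi i) = cls [j]" if "i < 4 * L" for i
  proof -
    consider "i < L" | "L \<le> i" "i < 2 * L" | "2 * L \<le> i" "i < 3 * L" | "3 * L \<le> i" by linarith
    then show ?thesis
    proof cases
      case 1
      then have "yi i = y1 i" "yi (Suc i) = y1 (Suc i)" by (auto simp: yi_def)
      moreover have "Suc i = Suc (i) \<or> i = Suc (Suc i)" using 1 that by arith
      ultimately show ?thesis using adj_m[OF y(1)] by simp
    next
      case 2
      then have "yi i = y1 (2 * L - i)" "yi (Suc i) = y1 (2 * L - Suc i)"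
        using L(2) by (auto simp: yi_def)
      moreover have "2 * L - Suc i = Suc (2 * L - i) \<or> 2 * L - i = Suc (2 * L - Suc i)" using 2 that by arith
      ultimately show ?thesis using adj_m[OF y(1)] by simp
    next
      case 3
      then have "yi i = y2 (i - 2 * L)" "yi (Suc i) = y2 (Suc i - 2 * L)"
        using L(2) y by (auto simp: yi_def)
      moreover have "Suc i - 2 * L = Suc (i - 2 * L) \<or> i - 2 * L = Suc (Suc i - 2 * L)" using 3 that by arith
      ultimately show ?thesis using adj_m[OF y(2)] by simp
    next
      case 4
      then have "yi i = y2 (4 * L - i)" "yi (Suc i) = y2 (4 * L - Suc i)"
        using L(2) that by (auto simp: yi_def)
      moreover have "4 * L - Suc i = Suc (4 * L - i) \<or> 4 * L - i = Suc (4 * L - Suc i)" using 4 that by arith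
      ultimately show ?thesis using adj_m[OF y(2)] by simp
    qed
  qed

  \<comment> \<open>Lifting the loop to \<open>G\<close> and summing \<open>\<omega>\<close> along
    it\<close>
  define gg where "gg c d = (SOME g. g \<in> carrier G \<and> \<phi> g c0 = c \<and> \<phi> g d0 = d)" for c d
  have gg: "gg c d \<in> carrier G \<and> \<phi> (gg c d) c0 = c \<and> \<phi> (gg c d) d0 = d"
    if "c \<in> Cp" "d \<in> Cm" "ds c d = cls []" for c d
    unfolding gg_def
    by (rule someI_ex) (use opposite_transitive[OF act strans c0 d0 opp that] in blast)
  define \<gamma> where "\<gamma> i = gg (xi i) (yi i)" for i
  have \<gamma>: "\<gamma> i \<in> carrier G" "\<phi> (\<gamma> i) c0 = xi i" "\<phi> (\<gamma> i) d0 = yi i" if "i \<le> 4 * L" for i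
    using gg[OF xiC yiC opp_i[OF that]] by (auto simp: \<gamma>_def)
  \<comment> \<open>\<open>gg\<close> chooses by the pair alone, so equal pairs at both ends give
    equal group elements.\<close>
  have closed: "\<gamma> (4 * L) = \<gamma> 0"
    using L(2) y by (simp add: \<gamma>_def xi_def yi_def)
  have steps: "inv\<^bsub>G\<^esub> (\<gamma> i) \<otimes>\<^bsub>G\<^esub> \<gamma> (Suc i) \<in> A" if i: "i < 4 * L" for i
  proof -
    have g: "\<gamma> i \<in> carrier G" "\<gamma> (Suc i) \<in> carrier G" using \<gamma> i by auto
    then have gc: "inv\<^bsub>G\<^esub> (\<gamma> i) \<otimes>\<^bsub>G\<^esub> \<gamma> (Suc i) \<in> carrier G" by simp
    show ?thesis
      unfolding A_def Np_def Nm_def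
      using gc pC[OF gc c0] mC[OF gc d0] dp_step[OF g] dm_step[OF g] \<gamma>[of i] \<gamma>[of "Suc i"]
        xi_adj[OF i] yi_adj[OF i] i by simp
  qed
  have "(\<Sum>i<4 * L. \<omega> (\<gamma> i) (\<gamma> (Suc i))) = 0"
    using fill[rule_format, of \<omega> "4 * L" \<gamma>] cocycle \<gamma>(1) closed steps by blast
  moreover have "(\<Sum>i<4 * L. \<omega> (\<gamma> i) (\<gamma> (Suc i))) = 1"
  proof -
    \<comment> \<open>\<open>h\<close> is 1 only on \<open>x1 a\<close> with
      \<open>a \<ge> 2\<close>: in the first quarter this means \<open>i < L - 1\<close>, and in the
      last quarter \<open>yi\<close> runs on \<open>y2\<close>, where \<open>k\<close> vanishes. The
      sum thus telescopes over one pass through the jump of \<open>k\<close> on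
      \<open>y1\<close>.\<close>
    have val: "\<omega> (\<gamma> i) (\<gamma> (Suc i)) = (if i < L - 1 then k (y1 (Suc i)) - k (y1 i) else 0)"
      if i: "i < 4 * L" for i
    proof -
      have e: "\<omega> (\<gamma> i) (\<gamma> (Suc i)) = h (xi i) * (k (yi (Suc i)) - k (yi i))"
        using \<gamma>[of i] \<gamma>[of "Suc i"] i by (simp add: \<omega>_def)
      consider "i < L - 1" | "L - 1 \<le> i" "i \<le> L" | "L < i" "i \<le> 3 * L" | "3 * L < i" by linarith
      then show ?thesis
      proof cases
        case 1
        then show ?thesis unfolding e by (auto simp: xi_def yi_def h1)
      next
        case 2
        then show ?thesis unfolding e by (auto simp: xi_def h1)
      next
        case 3
        then have "h (xi i) = 0" by (auto simp: xi_def h2)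
        then show ?thesis unfolding e using 3 by auto
      next
        case 4
        then have "k (yi i) = 0" "k (yi (Suc i)) = 0" by (auto simp: yi_def k2)
        then show ?thesis unfolding e using 4 by auto
      qed
    qed
    have "(\<Sum>i<4 * L. \<omega> (\<gamma> i) (\<gamma> (Suc i)))
        = (\<Sum>i<4 * L. if i < L - 1 then k (y1 (Suc i)) - k (y1 i) else 0)"
      using val by (intro sum.cong) auto
    also have "\<dots> = (\<Sum>i<L - 1. k (y1 (Suc i)) - k (y1 i))"
      by (intro sum.mono_neutral_cong_right) auto
    also have "\<dots> = k (y1 (L - 1)) - k (y1 0)" by (rule sum_lessThan_telescope)
    also have "\<dots> = 1" using L(2) by (simp add: k1)
    finally show ?thesis .
  qed
  ultimately show False by simp
qed

end

text \<open>Both conclusions come from the failure of \<open>loops_fill\<close>, so finite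
  presentability is excluded directly and not by passing through FP2. The type \<open>'m\<close>
  carrying the modules is arbitrary.\<close>

theorem mainTheorem9:
  fixes n :: nat and m :: "nat \<Rightarrow> nat \<Rightarrow> enat"
    and Cp Cm :: "'c set" and dp dm ds :: "'c \<Rightarrow> 'c \<Rightarrow> nat list set"
    and q :: "nat \<Rightarrow> nat"
    and G :: "('g, 'b) monoid_scheme" and \<phi> :: "'g \<Rightarrow> 'c \<Rightarrow> 'c"
    and c0 d0 :: 'c
  assumes cox: "coxeter_matrix n m"
    and condA: "condition_A n m"
    and twin: "twin_building n m Cp Cm dp dm ds"
    and panels: "\<forall>i<n. q i \<ge> 2 \<and>
        (\<forall>c\<in>Cp. card (panel n m Cp dp i c) = q i + 1) \<and>
        (\<forall>c\<in>Cm. card (panel n m Cm dm i c) = q i + 1)"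
    and act: "twin_building_action G \<phi> Cp Cm dp dm ds"
    and strans: "strongly_transitive n m G \<phi> Cp Cm dp dm ds"
    and c0: "c0 \<in> Cp" and d0: "d0 \<in> Cm" and opp: "ds c0 d0 = cox_one n m"
    and T_fin: "finite {g \<in> carrier G. \<phi> g c0 = c0 \<and> \<phi> g d0 = d0}"
  shows "\<not> FP2_in TYPE('m) G \<and> \<not> finitely_presented G"
proof -
  obtain J K where JK: "J \<inter> K = {}" "J \<union> K = {..<n}" and K: "card K \<ge> 2"
    and sph: "\<forall>s\<in>K. spherical n m (insert s J)"
    and free: "\<forall>s\<in>K. \<forall>t\<in>K. s \<noteq> t \<longrightarrow> m s t = \<infinity>"
    using condA unfolding condition_A_def by (elim exE conjE)
  have "finite K" using K by (intro card_ge_0_finite) simp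
  then have "\<not> (\<forall>s\<in>K. \<forall>t\<in>K. s = t)"
    using K by (simp flip: card_le_Suc0_iff_eq)
  then obtain s t where st: "s \<in> K" "t \<in> K" "s \<noteq> t" by blast
  have "finite {cox_cls n m w | w. set w \<subseteq> insert s J}"
    using sph st(1) unfolding spherical_def by blast
  then have sphJ: "spherical n m J" unfolding spherical_def by (rule rev_finite_subset) auto
  interpret split_twin n m J K s t Cp Cm dp dm ds
    by unfold_locales (fact cox, fact JK(1), fact JK(2), use free in blast, use st in blast, fact sphJ,
        fact st, fact st, fact st, fact twin)
  have "\<not> loops_fill G"
    by (rule not_loops_fill[OF panels[rule_format] act strans c0 d0 opp[unfolded cox_one_def] T_fin])
  moreover have "group G" by (rule act[unfolded twin_building_action_def, THEN conjunct1])
  ultimately show ?thesis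
    using group.FP2_loops_fill[of G] group.finitely_presented_loops_fill[of G] by blast
qed

end
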